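(* In the setting of the context: (i) the inclusion map $\iota:\mathcal H\hookrightarrow\mathrm{Hol}(\mathbb A(r^-,r^+),E)$ is injective and continuous, where $\mathrm{Hol}(\mathbb A(r^-,r^+),E)$ carries the topology of uniform convergence on compact sets; (ii) the linear span of $\{\Psi(\bar\lambda)e: e\in E,\ \lambda\in\Omega'\}$ is dense in $\mathcal H$; (iii) $\mathcal L\,\Psi(\bar\lambda)=\bar\lambda\,\Psi(\bar\lambda)$ for every $\lambda\in\Omega'$.
   Context: Notation: $\mathbb A(a,b)=\{z\in\mathbb C: a<|z|<b\}$; $\mathbf B(H)$ and $\mathbf B(E,\mathcal H)$ denote bounded linear operators; $\mathcal N(\cdot)$ is the kernel; $P_M$ is the orthogonal projection onto $M$; $\mathrm{Hol}(A,E)$ is the space of $E$-valued holomorphic functions on $A$. Setting. $H$ is a complex Hilbert space, $T\in\mathbf B(H)$ is left-invertible, $T'=T(T^*T)^{-1}$ is its Cauchy dual, and $T'^*=(T')^*$. $E$ is a closed subspace of $H$ such that the closed linear span of $\{T^{*n}x: x\in E,n\ge0\}\cup\{T'^{n}x: x\in E,n\ge 0\}$ is $H$, and the closed linear span of $\{T'^{*n}x: x\in E,n\ge0\}\cup\{T^{n}x: x\in E,n\ge 0\}$ is $H$. For every $x\in H$ the series $$U_x(z)=\sum_{n=1}^\infty (P_ET^nx)\frac1{z^n}+\sum_{n=0}^\infty(P_ET'^{*n}x)z^n,\qquad U'_x(z)=\sum_{n=1}^\infty (P_ET'^nx)\frac1{z^n}+\sum_{n=0}^\infty(P_ET^{*n}x)z^n$$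 are convergent in $E$ on the annuli $\Omega=\mathbb A(r^-,r^+)$ and $\Omega'=\mathbb A(r'^-,r'^+)$ respectively, where $0\le r^-<r^+$ and $0\le r'^-<r'^+$. Model space. $\mathcal H=\{U_x:x\in H\}$. The map $U:H\to\mathcal H$, $Ux=U_x$, is injective and $\mathcal H$ is given the norm induced from $H$, so that $U$ is unitary. $M_z:\mathcal H\to\mathcal H$ is multiplication by $z$ (one has $M_z=UTU^*$), and $\mathcal L:\mathcal H\to\mathcal H$ is its left inverse $$(\mathcal Lf)(z)=\frac{f(z)-(P_{\mathcal N(M_z^* )}f)(z)}{z}$$ (one has $\mathcal L=UT'^*U^*$). Identifying $e\in E$ with $Ue\in\mathcal H$, define $\Psi:(\Omega')^*\to\mathbf B(E,\mathcal H)$, where $(\Omega')^*=\{\bar z:z\in\Omega'\}$, by $$\Psi(\lambda)e=\sum_{n=1}^\infty\frac1{\lambda^n}\mathcal L^nUe+\sum_{n=0}^\infty\lambda^nM_z^nUe .$$ *)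

theory Defs
  imports "HOL-Analysis.Analysis" "HOL-Library.Function_Algebras"
begin

section \<open>Complex vector spaces and complex Hilbert spaces\<close>

class complex_vector = ab_group_add +
  fixes scaleC :: "complex \<Rightarrow> 'a \<Rightarrow> 'a"  (infixr \<open>*\<^sub>C\<close> 75)
  assumes scaleC_add_right: "a *\<^sub>C (x + y) = a *\<^sub>C x + a *\<^sub>C y"
    and scaleC_add_left: "(a + b) *\<^sub>C x = a *\<^sub>C x + b *\<^sub>C x"
    and scaleC_scaleC: "a *\<^sub>C b *\<^sub>C x = (a * b) *\<^sub>C x"
    and scaleC_one: "1 *\<^sub>C x = x"

global_interpretation complex_vector:
    vector_space "scaleC :: complex \<Rightarrow> 'a \<Rightarrow> 'a::complex_vector"
  defines csubspace = complex_vector.subspace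
    and cspan = complex_vector.span
  by unfold_locales
    (simp_all add: scaleC_add_right scaleC_add_left scaleC_scaleC scaleC_one)

instantiation "fun" :: (type, complex_vector) complex_vector
begin

definition scaleC_fun :: "complex \<Rightarrow> ('a \<Rightarrow> 'b) \<Rightarrow> 'a \<Rightarrow> 'b"
  where "c *\<^sub>C f = (\<lambda>x. c *\<^sub>C f x)"

instance
  by standard
    (simp_all add: scaleC_fun_def fun_eq_iff scaleC_add_right scaleC_add_left scaleC_scaleC scaleC_one)

end

text \<open>The inner product is linear in the first argument.  Positive definiteness is contained in
  the axiom that expresses the norm by the inner product, since \<open>cinner x x\<close> is real by
  conjugate symmetry; completeness comes from the class \<^class>\<open>banach\<close>.\<close>

class chilbert_space = complex_vector + banach +
  fixes cinner :: "'a \<Rightarrow> 'a \<Rightarrow> complex"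
  assumes scaleR_scaleC: "r *\<^sub>R x = complex_of_real r *\<^sub>C x"
    and cinner_commute: "cinner x y = cnj (cinner y x)"
    and cinner_add_left: "cinner (x + y) z = cinner x z + cinner y z"
    and cinner_scaleC_left: "cinner (c *\<^sub>C x) y = c * cinner x y"
    and norm_eq_sqrt_cinner: "norm x = sqrt (Re (cinner x x))"

instantiation complex :: chilbert_space
begin

definition scaleC_complex :: "complex \<Rightarrow> complex \<Rightarrow> complex"
  where "scaleC_complex = (*)"

definition cinner_complex :: "complex \<Rightarrow> complex \<Rightarrow> complex"
  where "cinner x y = x * cnj y"

instance
  by standard
    (simp_all add: scaleC_complex_def cinner_complex_def algebra_simps scaleR_conv_of_real
      cmod_def power2_eq_square)

end

section \<open>Operators\<close>

definition bounded_clinear :: "('a::chilbert_space \<Rightarrow> 'b::chilbert_space) \<Rightarrow> bool"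
  where "bounded_clinear A \<longleftrightarrow> bounded_linear A \<and> (\<forall>c x. A (c *\<^sub>C x) = c *\<^sub>C A x)"

definition left_invertible :: "('h::chilbert_space \<Rightarrow> 'h) \<Rightarrow> bool"
  where "left_invertible T \<longleftrightarrow> (\<exists>S. bounded_clinear S \<and> S \<circ> T = id)"

text \<open>Adjoints and orthogonal projections are defined relative to a carrier \<open>V\<close> and an inner
  product \<open>ip\<close> on it, because they are needed both on the type of \<open>H\<close> and on the model space, which
  is a set of functions.\<close>

definition adjoint_on ::
    "'v set \<Rightarrow> ('v \<Rightarrow> 'v \<Rightarrow> complex) \<Rightarrow> ('v \<Rightarrow> 'v) \<Rightarrow> 'v \<Rightarrow> 'v"
  where "adjoint_on V ip A y = (THE z. z \<in> V \<and> (\<forall>x\<in>V. ip (A x) y = ip x z))"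

definition orth_proj ::
    "('v \<Rightarrow> 'v \<Rightarrow> complex) \<Rightarrow> 'v set \<Rightarrow> 'v \<Rightarrow> 'v::ab_group_add"
  where "orth_proj ip M x = (THE y. y \<in> M \<and> (\<forall>m\<in>M. ip (x - y) m = 0))"

definition cadjoint :: "('h::chilbert_space \<Rightarrow> 'h) \<Rightarrow> 'h \<Rightarrow> 'h"
  where "cadjoint A = adjoint_on UNIV cinner A"

definition cauchy_dual :: "('h::chilbert_space \<Rightarrow> 'h) \<Rightarrow> 'h \<Rightarrow> 'h"
  where "cauchy_dual T = T \<circ> inv (cadjoint T \<circ> T)"

section \<open>Vector-valued holomorphic functions\<close>

definition annulus :: "real \<Rightarrow> real \<Rightarrow> complex set"
  where "annulus a b = {z. a < cmod z \<and> cmod z < b}"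

text \<open>Functions on an open set \<open>\<Omega>\<close> are represented by total functions that vanish off \<open>\<Omega>\<close>, so that
  equality and the linear operations are the ones of the function type.\<close>

definition Hol :: "complex set \<Rightarrow> 'h::chilbert_space set \<Rightarrow> (complex \<Rightarrow> 'h) set"
  where "Hol \<Omega> E = {f. (\<forall>z\<in>\<Omega>. f z \<in> E) \<and> (\<forall>z. z \<notin> \<Omega> \<longrightarrow> f z = 0) \<and>
    (\<forall>z\<in>\<Omega>. \<exists>D. ((\<lambda>w. (1 / (w - z)) *\<^sub>C (f w - f z)) \<longlongrightarrow> D) (at z))}"

text \<open>The topology of uniform convergence on compact sets.\<close>

definition hol_open :: "complex set \<Rightarrow> 'h::chilbert_space set \<Rightarrow> (complex \<Rightarrow> 'h) set \<Rightarrow> bool"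
  where "hol_open \<Omega> E W \<longleftrightarrow> W \<subseteq> Hol \<Omega> E \<and>
    (\<forall>f\<in>W. \<exists>K \<epsilon>. compact K \<and> K \<subseteq> \<Omega> \<and> 0 < \<epsilon> \<and>
       {g \<in> Hol \<Omega> E. \<forall>z\<in>K. norm (g z - f z) < \<epsilon>} \<subseteq> W)"

definition hol_topology :: "complex set \<Rightarrow> 'h::chilbert_space set \<Rightarrow> (complex \<Rightarrow> 'h) topology"
  where "hol_topology \<Omega> E = topology (hol_open \<Omega> E)"

lemma istopology_hol_open: "istopology (hol_open \<Omega> E)"
  unfolding istopology_def
proof (intro conjI allI impI)
  fix S T assume S: "hol_open \<Omega> E S" and T: "hol_open \<Omega> E T"
  show "hol_open \<Omega> E (S \<inter> T)"
    unfolding hol_open_def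
  proof (intro conjI ballI)
    show "S \<inter> T \<subseteq> Hol \<Omega> E" using S by (auto simp: hol_open_def)
    fix f assume f: "f \<in> S \<inter> T"
    obtain K \<epsilon> where K: "compact K" "K \<subseteq> \<Omega>" "0 < \<epsilon>"
        "{g \<in> Hol \<Omega> E. \<forall>z\<in>K. norm (g z - f z) < \<epsilon>} \<subseteq> S"
      using S f by (auto simp: hol_open_def)
    obtain L \<delta> where L: "compact L" "L \<subseteq> \<Omega>" "0 < \<delta>"
        "{g \<in> Hol \<Omega> E. \<forall>z\<in>L. norm (g z - f z) < \<delta>} \<subseteq> T"
      using T f by (auto simp: hol_open_def)
    have "{g \<in> Hol \<Omega> E. \<forall>z\<in>K \<union> L. norm (g z - f z) < min \<epsilon> \<delta>} \<subseteq> S \<inter> T"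
      using K(4) L(4) by auto
    then show "\<exists>K \<epsilon>. compact K \<and> K \<subseteq> \<Omega> \<and> 0 < \<epsilon> \<and>
        {g \<in> Hol \<Omega> E. \<forall>z\<in>K. norm (g z - f z) < \<epsilon>} \<subseteq> S \<inter> T"
      using K L by (intro exI[of _ "K \<union> L"] exI[of _ "min \<epsilon> \<delta>"]) (auto intro: compact_Un)
  qed
next
  fix \<K> :: "(complex \<Rightarrow> 'a) set set" assume *: "\<forall>S\<in>\<K>. hol_open \<Omega> E S"
  show "hol_open \<Omega> E (\<Union>\<K>)"
    unfolding hol_open_def
  proof (intro conjI ballI)
    show "\<Union>\<K> \<subseteq> Hol \<Omega> E" using * by (auto simp: hol_open_def)
    fix f assume "f \<in> \<Union>\<K>"
    then obtain S where S: "S \<in> \<K>" "f \<in> S" by blast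
    then obtain K \<epsilon> where "compact K" "K \<subseteq> \<Omega>" "0 < \<epsilon>"
        "{g \<in> Hol \<Omega> E. \<forall>z\<in>K. norm (g z - f z) < \<epsilon>} \<subseteq> S"
      using * unfolding hol_open_def by meson
    then show "\<exists>K \<epsilon>. compact K \<and> K \<subseteq> \<Omega> \<and> 0 < \<epsilon> \<and>
        {g \<in> Hol \<Omega> E. \<forall>z\<in>K. norm (g z - f z) < \<epsilon>} \<subseteq> \<Union>\<K>"
      using S(1) by (intro exI[of _ K] exI[of _ \<epsilon>]) blast
  qed
qed

lemma openin_hol_topology: "openin (hol_topology \<Omega> E) = hol_open \<Omega> E"
  by (simp add: hol_topology_def topology_inverse' istopology_hol_open)

lemma topspace_hol_topology: "topspace (hol_topology \<Omega> E) = Hol \<Omega> E"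
proof
  show "topspace (hol_topology \<Omega> E) \<subseteq> Hol \<Omega> E"
    using openin_topspace[of "hol_topology \<Omega> E"]
    by (simp add: openin_hol_topology hol_open_def)
  have "hol_open \<Omega> E (Hol \<Omega> E)"
    unfolding hol_open_def
    by (intro conjI ballI exI[of _ "{}"] exI[of _ 1]) auto
  then show "Hol \<Omega> E \<subseteq> topspace (hol_topology \<Omega> E)"
    by (simp add: openin_subset openin_hol_topology)
qed

section \<open>The model space\<close>

text \<open>\<open>A\<close> generates the principal part and \<open>B\<close> the regular part of the Laurent series: \<open>U\<^sub>x\<close> is
  obtained from \<open>A = T\<close>, \<open>B = T'\<^sup>*\<close>, and \<open>U'\<^sub>x\<close> from \<open>A = T'\<close>, \<open>B = T\<^sup>*\<close>.  The principal part is indexed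
  by \<open>n + 1\<close>.\<close>

definition principal_term ::
    "('h::chilbert_space \<Rightarrow> 'h) \<Rightarrow> 'h set \<Rightarrow> 'h \<Rightarrow> complex \<Rightarrow> nat \<Rightarrow> 'h"
  where "principal_term A E x z n = (1 / z ^ Suc n) *\<^sub>C orth_proj cinner E ((A ^^ Suc n) x)"

definition regular_term ::
    "('h::chilbert_space \<Rightarrow> 'h) \<Rightarrow> 'h set \<Rightarrow> 'h \<Rightarrow> complex \<Rightarrow> nat \<Rightarrow> 'h"
  where "regular_term B E x z n = z ^ n *\<^sub>C orth_proj cinner E ((B ^^ n) x)"

definition laurent_convergent ::
    "('h::chilbert_space \<Rightarrow> 'h) \<Rightarrow> ('h \<Rightarrow> 'h) \<Rightarrow> 'h set \<Rightarrow> complex set \<Rightarrow> bool"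
  where "laurent_convergent A B E \<Omega> \<longleftrightarrow>
    (\<forall>x. \<forall>z\<in>\<Omega>. summable (principal_term A E x z) \<and> summable (regular_term B E x z))"

definition model_map ::
    "('h::chilbert_space \<Rightarrow> 'h) \<Rightarrow> 'h set \<Rightarrow> complex set \<Rightarrow> 'h \<Rightarrow> complex \<Rightarrow> 'h"
  where "model_map T E \<Omega> x z =
    (if z \<in> \<Omega>
     then (\<Sum>n. principal_term T E x z n) + (\<Sum>n. regular_term (cadjoint (cauchy_dual T)) E x z n)
     else 0)"

definition model_space ::
    "('h::chilbert_space \<Rightarrow> 'h) \<Rightarrow> 'h set \<Rightarrow> complex set \<Rightarrow> (complex \<Rightarrow> 'h) set"
  where "model_space T E \<Omega> = range (model_map T E \<Omega>)"

text \<open>The Hilbert space structure transported from \<open>H\<close> along the injection \<^const>\<open>model_map\<close>.\<close>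

definition model_inner ::
    "('h::chilbert_space \<Rightarrow> 'h) \<Rightarrow> 'h set \<Rightarrow> complex set \<Rightarrow>
     (complex \<Rightarrow> 'h) \<Rightarrow> (complex \<Rightarrow> 'h) \<Rightarrow> complex"
  where "model_inner T E \<Omega> f g =
    cinner (inv (model_map T E \<Omega>) f) (inv (model_map T E \<Omega>) g)"

definition model_norm ::
    "('h::chilbert_space \<Rightarrow> 'h) \<Rightarrow> 'h set \<Rightarrow> complex set \<Rightarrow> (complex \<Rightarrow> 'h) \<Rightarrow> real"
  where "model_norm T E \<Omega> f = norm (inv (model_map T E \<Omega>) f)"

definition model_topology ::
    "('h::chilbert_space \<Rightarrow> 'h) \<Rightarrow> 'h set \<Rightarrow> complex set \<Rightarrow> (complex \<Rightarrow> 'h) topology"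
  where "model_topology T E \<Omega> =
    Metric_space.mtopology (model_space T E \<Omega>) (\<lambda>f g. model_norm T E \<Omega> (f - g))"

definition model_Mz :: "(complex \<Rightarrow> 'h::chilbert_space) \<Rightarrow> complex \<Rightarrow> 'h"
  where "model_Mz f = (\<lambda>z. z *\<^sub>C f z)"

definition model_kernel_adj ::
    "('h::chilbert_space \<Rightarrow> 'h) \<Rightarrow> 'h set \<Rightarrow> complex set \<Rightarrow> (complex \<Rightarrow> 'h) set"
  where "model_kernel_adj T E \<Omega> =
    {f \<in> model_space T E \<Omega>.
       adjoint_on (model_space T E \<Omega>) (model_inner T E \<Omega>) model_Mz f = 0}"

text \<open>Off \<open>\<Omega>\<close> the quotient below is \<open>0\<close>, because both functions in the numerator vanish there;
  \<open>0 \<notin> \<Omega>\<close> for the annuli under consideration.\<close>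

definition model_L ::
    "('h::chilbert_space \<Rightarrow> 'h) \<Rightarrow> 'h set \<Rightarrow> complex set \<Rightarrow>
     (complex \<Rightarrow> 'h) \<Rightarrow> complex \<Rightarrow> 'h"
  where "model_L T E \<Omega> f =
    (\<lambda>z. (1 / z) *\<^sub>C
       (f z - orth_proj (model_inner T E \<Omega>) (model_kernel_adj T E \<Omega>) f z))"

text \<open>Sum of a series in the norm of the model space.\<close>

definition model_suminf ::
    "('h::chilbert_space \<Rightarrow> 'h) \<Rightarrow> 'h set \<Rightarrow> complex set \<Rightarrow>
     (nat \<Rightarrow> complex \<Rightarrow> 'h) \<Rightarrow> complex \<Rightarrow> 'h"
  where "model_suminf T E \<Omega> a =
    (THE s. limitin (model_topology T E \<Omega>) (\<lambda>N. \<Sum>n<N. a n) s sequentially)"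

definition model_Psi ::
    "('h::chilbert_space \<Rightarrow> 'h) \<Rightarrow> 'h set \<Rightarrow> complex set \<Rightarrow>
     complex \<Rightarrow> 'h \<Rightarrow> complex \<Rightarrow> 'h"
  where "model_Psi T E \<Omega> \<mu> e =
    model_suminf T E \<Omega>
      (\<lambda>n. (1 / \<mu> ^ Suc n) *\<^sub>C (model_L T E \<Omega> ^^ Suc n) (model_map T E \<Omega> e)) +
    model_suminf T E \<Omega>
      (\<lambda>n. \<mu> ^ n *\<^sub>C (model_Mz ^^ n) (model_map T E \<Omega> e))"

end

theory Submission
  imports Defs "HOL-Complex_Analysis.Complex_Analysis"
begin

text \<open>
  Write \<open>L = T'\<^sup>*\<close>.  Then \<open>L T = 1\<close>, and \<open>1 - T L\<close> is the orthogonal projection to the kernel of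
  \<open>T\<^sup>*\<close> (\<open>L_T\<close> and \<open>cadjoint_T_T_L\<close>).  Shifting the summation index in the Laurent series gives
  \<open>z U\<^sub>x = U\<^sub>T\<^sub>x\<close>, so the left inverse \<open>f \<mapsto> (f - Q f) / z\<close> of the model, with \<open>Q\<close> the projection to the
  kernel of the adjoint of multiplication by \<open>z\<close>, sends \<open>U\<^sub>x\<close> to \<open>z\<^sup>-\<^sup>1 U\<^sub>T\<^sub>L\<^sub>x = U\<^sub>L\<^sub>x\<close>.  Everything
  in the model space can therefore be computed in \<open>H\<close>.

  Two general facts about a pair of operators \<open>A\<close>, \<open>B\<close> whose Laurent series converge on an annulus
  carry the proof; they are applied to \<open>(T, T'\<^sup>*)\<close> and to \<open>(T', T\<^sup>*)\<close>.

  First, convergence for every \<open>x\<close> implies, by the uniform boundedness principle, that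
  \<open>norm (P\<^sub>E A^n x) \<le> C \<rho>^n norm x\<close> for \<open>n \<ge> 1\<close> and \<open>norm (P\<^sub>E B^n x) \<le> C \<rho>^(-n) norm x\<close> for \<open>n \<ge> 0\<close>,
  for each \<open>\<rho>\<close> strictly between the radii.  Summing geometric series bounds \<open>U\<^sub>x\<close> on compact subsets
  of the annulus by a multiple of \<open>norm x\<close> (\<open>laurent_sum_bound\<close>), which is the continuity of the
  inclusion.  By duality, the same estimates hold for \<open>A\<^sup>*^n\<close> and \<open>B\<^sup>*^n\<close> on \<open>E\<close>; for the pair
  \<open>(T', T\<^sup>*)\<close> this says that the orbit series
  \<open>\<psi>\<^sub>e(\<lambda>) = \<Sum>n\<ge>1. \<lambda>^(-n) L^n e + \<Sum>n\<ge>0. \<lambda>^n T^n e\<close>, whose image under \<open>U\<close> is \<open>\<Psi>(\<lambda>) e\<close>,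
  converges absolutely.  Since \<open>L\<close> shifts the index of this series by one,
  \<open>L \<psi>\<^sub>e(\<lambda>) = \<lambda> \<psi>\<^sub>e(\<lambda>)\<close> (\<open>L_orbit_series\<close>).

  Second, the Laurent sum of \<open>x\<close> determines the inner products of \<open>x\<close> with the orbits of \<open>E\<close> under
  \<open>A\<^sup>*\<close> and \<open>B\<^sup>*\<close>, by uniqueness of Laurent coefficients (\<open>laurent_series_eq_0\<close>); so if these orbits
  span a dense subspace, the sum vanishes only for \<open>x = 0\<close>.  For \<open>(T, T'\<^sup>*)\<close> this is the injectivity
  of \<open>U\<close>.  For \<open>(T', T\<^sup>*)\<close> it is the density of the span of the vectors \<open>\<psi>\<^sub>e(cnj \<lambda>)\<close>, because
  \<open>cinner y (\<psi>\<^sub>e(cnj \<lambda>)) = cinner (U'\<^sub>y(\<lambda>)) e\<close> (\<open>cinner_laurent_kernel\<close>).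
\<close>

section \<open>Geometry of complex Hilbert spaces\<close>

lemma cinner_add_right: "cinner x (y + z) = cinner x y + cinner (x :: 'h::chilbert_space) z"
  by (metis cinner_add_left cinner_commute complex_cnj_add)

lemma cinner_scaleC_right: "cinner x (c *\<^sub>C y) = cnj c * cinner (x :: 'h::chilbert_space) y"
  by (metis cinner_commute cinner_scaleC_left complex_cnj_mult)

lemma scaleC_zero_left [simp]: "0 *\<^sub>C x = (0 :: 'h::complex_vector)"
  by (rule complex_vector.scale_zero_left)

lemma cinner_zero_left [simp]: "cinner 0 (x :: 'h::chilbert_space) = 0"
  using cinner_scaleC_left[of 0 0 x] by simp

lemma cinner_zero_right [simp]: "cinner (x :: 'h::chilbert_space) 0 = 0"
  using cinner_scaleC_right[of x 0 0] by simp

lemma cinner_diff_left: "cinner (x - y) z = cinner x z - cinner (y :: 'h::chilbert_space) z"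
  using cinner_add_left[of "x - y" y z] by simp

lemma cinner_diff_right: "cinner z (x - y) = cinner z x - cinner z (y :: 'h::chilbert_space)"
  using cinner_add_right[of z "x - y" y] by simp

lemma cinner_self: "cinner x x = of_real ((norm (x :: 'h::chilbert_space))\<^sup>2)"
proof -
  have "Im (cinner x x) = 0"
    using cinner_commute[of x x] by (simp add: complex_eq_iff)
  moreover have "0 \<le> Re (cinner x x)"
    using norm_ge_zero[of x] by (simp add: norm_eq_sqrt_cinner)
  ultimately show ?thesis
    by (simp add: norm_eq_sqrt_cinner complex_eq_iff)
qed

lemma cinner_self_eq_0 [simp]: "cinner x x = 0 \<longleftrightarrow> x = (0 :: 'h::chilbert_space)"
  by (simp add: cinner_self)

lemma norm_add_squared:
  "(norm (x + y))\<^sup>2 = (norm x)\<^sup>2 + (norm y)\<^sup>2 + 2 * Re (cinner x (y :: 'h::chilbert_space))"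
proof -
  have "complex_of_real ((norm (x + y))\<^sup>2) = cinner (x + y) (x + y)"
    by (simp add: cinner_self)
  also have "\<dots> = cinner x x + cinner y y + (cinner x y + cnj (cinner x y))"
    by (simp add: cinner_add_left cinner_add_right cinner_commute[of y x])
  finally show ?thesis
    by (simp add: cinner_self complex_eq_iff)
qed

lemma norm_scaleC: "norm (c *\<^sub>C x) = cmod c * norm (x :: 'h::chilbert_space)"
proof -
  have "complex_of_real ((norm (c *\<^sub>C x))\<^sup>2) = cinner (c *\<^sub>C x) (c *\<^sub>C x)"
    by (simp add: cinner_self)
  also have "\<dots> = (c * cnj c) * cinner x x"
    by (simp add: cinner_scaleC_left cinner_scaleC_right)
  also have "\<dots> = of_real ((cmod c * norm x)\<^sup>2)"
    by (simp add: cinner_self complex_mult_cnj cmod_power2 power_mult_distrib)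
  finally show ?thesis
    by (metis norm_ge_zero mult_nonneg_nonneg of_real_eq_iff power2_eq_imp_eq)
qed

lemma parallelogram_law:
  "(norm (x + y))\<^sup>2 + (norm (x - y))\<^sup>2 = 2 * (norm x)\<^sup>2 + 2 * (norm (y :: 'h::chilbert_space))\<^sup>2"
  using norm_add_squared[of x y] norm_add_squared[of x "- y"] cinner_diff_right[of x 0 y] by simp

lemma Re_cinner_le: "Re (cinner x y) \<le> norm x * norm (y :: 'h::chilbert_space)"
proof -
  have "(norm (x + y))\<^sup>2 \<le> (norm x + norm y)\<^sup>2"
    by (intro power_mono norm_triangle_ineq) simp
  then show ?thesis
    by (simp add: norm_add_squared power2_sum)
qed

lemma norm_cinner_le: "cmod (cinner x y) \<le> norm x * norm (y :: 'h::chilbert_space)"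
proof (cases "cinner x y = 0")
  case False
  \<comment> \<open>Rotating \<open>x\<close> by a phase makes the inner product real.\<close>
  define u where "u = cnj (cinner x y) / cmod (cinner x y)"
  have u: "cmod u = 1" using False by (simp add: u_def norm_divide)
  have "cinner (u *\<^sub>C x) y = cmod (cinner x y)"
    using False by (simp add: u_def cinner_scaleC_left complex_norm_square[symmetric]
        power2_eq_square field_simps)
  then have "cmod (cinner x y) = Re (cinner (u *\<^sub>C x) y)" by simp
  also have "\<dots> \<le> norm x * norm y"
    using Re_cinner_le[of "u *\<^sub>C x" y] by (simp add: norm_scaleC u)
  finally show ?thesis .
qed simp

lemma bounded_linear_cinner_left: "bounded_linear (\<lambda>x :: 'h::chilbert_space. cinner x y)"
  by (rule bounded_linear_intro[where K = "norm y"])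
    (simp_all add: cinner_add_left scaleR_scaleC cinner_scaleC_left norm_cinner_le scaleC_complex_def)

lemma bounded_linear_cinner_right: "bounded_linear (\<lambda>y :: 'h::chilbert_space. cinner x y)"
  by (rule bounded_linear_intro[where K = "norm x"])
    (use norm_cinner_le[of x] in \<open>simp_all add: cinner_add_right scaleR_scaleC cinner_scaleC_right
      scaleC_complex_def mult.commute\<close>)

lemma bounded_linear_scaleC_right: "bounded_linear (\<lambda>x :: 'h::chilbert_space. c *\<^sub>C x)"
  by (rule bounded_linear_intro[where K = "cmod c"])
    (simp_all add: scaleC_add_right scaleR_scaleC scaleC_scaleC norm_scaleC mult.commute)

lemma bounded_bilinear_scaleC:
  "bounded_bilinear (scaleC :: complex \<Rightarrow> 'h::chilbert_space \<Rightarrow> 'h)"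
  by unfold_locales
    (auto simp: scaleC_add_left scaleC_add_right scaleR_scaleC scaleC_scaleC norm_scaleC
      scaleC_complex_def mult.commute intro!: exI[of _ 1])

lemma cinner_eqI:
  assumes "\<And>z. cinner x z = cinner (y :: 'h::chilbert_space) z"
  shows "x = y"
  using assms[of "x - y"] cinner_self_eq_0[of "x - y"]
  by (simp add: cinner_diff_left del: cinner_self_eq_0)

lemma cinner_eqI_right:
  assumes "\<And>z. cinner z x = cinner z (y :: 'h::chilbert_space)"
  shows "x = y"
  by (rule cinner_eqI) (metis assms cinner_commute)

subsection \<open>Orthogonal projections\<close>

text \<open>A minimising sequence for the distance from \<open>x\<close> to \<open>M\<close> is Cauchy by the parallelogram law;
  its limit is the foot of the perpendicular, since perturbing it inside \<open>M\<close> cannot decrease the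
  distance.\<close>

lemma orthogonal_foot_exists:
  fixes M :: "'h::chilbert_space set"
  assumes M: "csubspace M" "closed M"
  shows "\<exists>y\<in>M. \<forall>m\<in>M. cinner (x - y) m = 0"
proof -
  define d where "d = (INF y\<in>M. norm (x - y))"
  have M0: "0 \<in> M" using M(1) by (rule complex_vector.subspace_0)
  have bdd: "bdd_below ((\<lambda>y. norm (x - y)) ` M)" by (rule bdd_belowI[of _ 0]) auto
  have d_le: "d \<le> norm (x - y)" if "y \<in> M" for y
    unfolding d_def using bdd that by (rule cINF_lower)
  have d0: "0 \<le> d" unfolding d_def using M0 by (intro cINF_greatest) auto
  have "\<exists>y\<in>M. norm (x - y) < d + 1 / Suc n" for n
    using cINF_less_iff[of M "\<lambda>y. norm (x - y)" "d + 1 / Suc n"] M0 bdd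
    by (auto simp: d_def[symmetric])
  then obtain y where yM: "\<And>n. y n \<in> M" and yd: "\<And>n. norm (x - y n) < d + 1 / Suc n"
    by metis
  have half: "(1/2) *\<^sub>R (u + v) \<in> M" if "u \<in> M" "v \<in> M" for u v
    using that M(1) by (simp add: scaleR_scaleC complex_vector.subspace_add
        complex_vector.subspace_scale)
  have lim: "(\<lambda>n. norm (x - y n)) \<longlonglongrightarrow> d"
  proof (rule tendsto_sandwich)
    show "\<forall>\<^sub>F n in sequentially. d \<le> norm (x - y n)"
      by (simp add: d_le yM)
    show "\<forall>\<^sub>F n in sequentially. norm (x - y n) \<le> d + inverse (real (Suc n))"
      using yd by (simp add: less_imp_le inverse_eq_divide)
  qed (rule tendsto_const LIMSEQ_inverse_real_of_nat_add)+
  have gap: "(norm (y m - y n))\<^sup>2 \<le> 2 * ((norm (x - y m))\<^sup>2 - d\<^sup>2) + 2 * ((norm (x - y n))\<^sup>2 - d\<^sup>2)" for m n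
  proof -
    have "norm ((x - y m) + (x - y n)) = 2 * norm (x - (1/2) *\<^sub>R (y m + y n))"
      using norm_scaleR[of 2 "x - (1/2) *\<^sub>R (y m + y n)"]
      by (simp add: scaleR_right_diff_distrib scaleR_2 algebra_simps)
    also have "\<dots> \<ge> 2 * d" using d_le[OF half[OF yM yM]] by simp
    finally have "(2 * d)\<^sup>2 \<le> (norm ((x - y m) + (x - y n)))\<^sup>2"
      using d0 by (intro power_mono) auto
    then show ?thesis
      using parallelogram_law[of "x - y m" "x - y n"] by (simp add: norm_minus_commute power_mult_distrib)
  qed
  have "Cauchy y"
  proof (rule metric_CauchyI)
    fix e :: real assume "0 < e"
    have "(\<lambda>n. (norm (x - y n))\<^sup>2 - d\<^sup>2) \<longlonglongrightarrow> d\<^sup>2 - d\<^sup>2"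
      by (intro tendsto_intros lim)
    then have "eventually (\<lambda>n. (norm (x - y n))\<^sup>2 - d\<^sup>2 < e\<^sup>2 / 4) sequentially"
      using \<open>0 < e\<close> by (intro order_tendstoD(2)) auto
    then obtain N where N: "\<And>n. n \<ge> N \<Longrightarrow> (norm (x - y n))\<^sup>2 - d\<^sup>2 < e\<^sup>2 / 4"
      by (auto simp: eventually_sequentially)
    show "\<exists>M. \<forall>m\<ge>M. \<forall>n\<ge>M. dist (y m) (y n) < e"
    proof (intro exI allI impI)
      fix m n assume "N \<le> m" "N \<le> n"
      then have "(norm (y m - y n))\<^sup>2 < e\<^sup>2"
        using gap[of m n] N[of m] N[of n] by simp
      then show "dist (y m) (y n) < e"
        using \<open>0 < e\<close> by (simp add: dist_norm power_less_imp_less_base)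
    qed
  qed
  then obtain z where z: "y \<longlonglongrightarrow> z"
    using Cauchy_convergent convergent_def by blast
  have zM: "z \<in> M"
    using M(2) yM z closed_sequentially by blast
  have "(\<lambda>n. norm (x - y n)) \<longlonglongrightarrow> norm (x - z)"
    by (intro tendsto_intros z)
  then have zd: "norm (x - z) = d"
    using lim LIMSEQ_unique by blast
  have "cinner (x - z) m = 0" if m: "m \<in> M" for m
  proof (cases "m = 0")
    case False
    \<comment> \<open>Subtracting from \<open>x - z\<close> its component along \<open>m\<close> would strictly decrease the norm.\<close>
    define c where "c = cinner (x - z) m / of_real ((norm m)\<^sup>2)"
    define w where "w = x - (z + c *\<^sub>C m)"
    have "cinner w m = 0"
      using False by (simp add: w_def c_def cinner_diff_left cinner_add_left cinner_scaleC_left cinner_self)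
    then have "cinner w (c *\<^sub>C m) = 0" by (simp add: cinner_scaleC_right)
    then have "(norm (w + c *\<^sub>C m))\<^sup>2 = (norm w)\<^sup>2 + (norm (c *\<^sub>C m))\<^sup>2"
      by (simp add: norm_add_squared)
    moreover have "w + c *\<^sub>C m = x - z" by (simp add: w_def)
    moreover have "d \<le> norm w"
      unfolding w_def by (intro d_le complex_vector.subspace_add complex_vector.subspace_scale M(1) zM m)
    then have "d\<^sup>2 \<le> (norm w)\<^sup>2" using d0 by (intro power_mono)
    ultimately have "(norm (c *\<^sub>C m))\<^sup>2 \<le> 0" using zd by simp
    then have "c = 0" using False by (simp add: norm_scaleC)
    then show ?thesis using False by (simp add: c_def)
  qed simp
  then show ?thesis using zM by blast
qed

lemma orth_proj_eqI:
  fixes M :: "'h::chilbert_space set"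
  assumes M: "csubspace M" and y: "y \<in> M" "\<And>m. m \<in> M \<Longrightarrow> cinner (x - y) m = 0"
  shows "orth_proj cinner M x = y"
  unfolding orth_proj_def
proof (rule the_equality)
  fix y' assume y': "y' \<in> M \<and> (\<forall>m\<in>M. cinner (x - y') m = 0)"
  have "y' - y \<in> M" using M y y' by (simp add: complex_vector.subspace_diff)
  then have "cinner ((x - y) - (x - y')) (y' - y) = 0"
    using y y' by (simp add: cinner_diff_left)
  then show "y' = y" by simp
qed (use y in blast)

lemma
  fixes M :: "'h::chilbert_space set"
  assumes M: "csubspace M" "closed M"
  shows orth_proj_in: "orth_proj cinner M x \<in> M"
    and orth_proj_orth: "m \<in> M \<Longrightarrow> cinner (x - orth_proj cinner M x) m = 0"
  using orthogonal_foot_exists[OF M, of x] orth_proj_eqI[OF M(1)] by metis+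

lemma cinner_orth_proj:
  fixes M :: "'h::chilbert_space set"
  assumes M: "csubspace M" "closed M" "m \<in> M"
  shows "cinner (orth_proj cinner M x) m = cinner x m"
  using orth_proj_orth[OF M, of x] by (simp add: cinner_diff_left)

lemma bounded_clinear_orth_proj:
  fixes M :: "'h::chilbert_space set"
  assumes M: "csubspace M" "closed M"
  shows "bounded_clinear (orth_proj cinner M)"
proof -
  let ?P = "orth_proj cinner M"
  note sub = complex_vector.subspace_add[OF M(1)] complex_vector.subspace_scale[OF M(1)]
  have add: "?P (x + y) = ?P x + ?P y" for x y
    by (rule orth_proj_eqI)
      (auto simp: M sub orth_proj_in cinner_diff_left cinner_add_left cinner_orth_proj)
  have scale: "?P (c *\<^sub>C x) = c *\<^sub>C ?P x" for c x
    by (rule orth_proj_eqI)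
      (auto simp: M sub orth_proj_in cinner_diff_left cinner_scaleC_left cinner_orth_proj)
  have "norm (?P x) \<le> norm x * 1" for x
  proof -
    have "cinner (?P x) (x - ?P x) = 0"
      using orth_proj_orth[OF M orth_proj_in[OF M]] by (simp add: cinner_commute[of "?P x"])
    then have "(norm x)\<^sup>2 = (norm (?P x))\<^sup>2 + (norm (x - ?P x))\<^sup>2"
      using norm_add_squared[of "?P x" "x - ?P x"] by simp
    then have "(norm (?P x))\<^sup>2 \<le> (norm x)\<^sup>2" by simp
    then show ?thesis using power2_le_imp_le[of "norm (?P x)" "norm x"] by simp
  qed
  then show ?thesis
    unfolding bounded_clinear_def
    by (auto intro!: bounded_linear_intro[where K = 1] simp: add scale scaleR_scaleC)
qed

lemma closure_cspan_eq_UNIV_iff: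
  fixes S :: "'h::chilbert_space set"
  shows "closure (cspan S) = UNIV \<longleftrightarrow> (\<forall>y. (\<forall>s\<in>S. cinner y s = 0) \<longrightarrow> y = 0)"
proof
  assume dense: "closure (cspan S) = UNIV"
  show "\<forall>y. (\<forall>s\<in>S. cinner y s = 0) \<longrightarrow> y = 0"
  proof (intro allI impI)
    fix y assume y: "\<forall>s\<in>S. cinner y s = 0"
    have "csubspace {s. cinner y s = 0}"
      by (rule complex_vector.subspaceI) (simp_all add: cinner_add_right cinner_scaleC_right)
    then have "cspan S \<subseteq> {s. cinner y s = 0}"
      using y by (intro complex_vector.span_minimal) auto
    moreover have "closed {s. cinner y s = 0}"
      by (intro closed_Collect_eq continuous_on_const
          linear_continuous_on[OF bounded_linear_cinner_right])
    ultimately have "closure (cspan S) \<subseteq> {s. cinner y s = 0}"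
      by (rule closure_minimal)
    then have "cinner y y = 0" using dense by blast
    then show "y = 0" by simp
  qed
next
  assume *: "\<forall>y. (\<forall>s\<in>S. cinner y s = 0) \<longrightarrow> y = 0"
  let ?M = "closure (cspan S)"
  have M: "csubspace ?M"
  proof (rule complex_vector.subspaceI)
    show "0 \<in> ?M" using closure_subset complex_vector.span_zero by blast
    fix x y assume x: "x \<in> ?M" and y: "y \<in> ?M"
    then obtain f g where "\<And>n. f n \<in> cspan S" "f \<longlonglongrightarrow> x" "\<And>n. g n \<in> cspan S" "g \<longlonglongrightarrow> y"
      unfolding closure_sequential by metis
    then show "x + y \<in> ?M"
      unfolding closure_sequential
      by (intro exI[of _ "\<lambda>n. f n + g n"]) (auto intro: complex_vector.span_add tendsto_add)
  next
    fix c x assume "x \<in> ?M"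
    then obtain f where "\<And>n. f n \<in> cspan S" "f \<longlonglongrightarrow> x"
      unfolding closure_sequential by metis
    then show "c *\<^sub>C x \<in> ?M"
      unfolding closure_sequential
      by (intro exI[of _ "\<lambda>n. c *\<^sub>C f n"])
        (auto intro: complex_vector.span_scale bounded_linear.tendsto[OF bounded_linear_scaleC_right])
  qed
  have "x \<in> ?M" for x
  proof -
    let ?P = "orth_proj cinner ?M"
    have "S \<subseteq> ?M" using complex_vector.span_superset closure_subset by blast
    then have "\<forall>s\<in>S. cinner (x - ?P x) s = 0"
      using orth_proj_orth[OF M closed_closure] by blast
    then have "x = ?P x" using * by force
    then show ?thesis using orth_proj_in[OF M closed_closure] by metis
  qed
  then show "?M = UNIV" by blast
qed

subsection \<open>Bounded operators and their adjoints\<close>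

lemma
  assumes "bounded_clinear A"
  shows bounded_clinear_bounded_linear: "bounded_linear A"
    and bounded_clinear_add: "A (x + y) = A x + A y"
    and bounded_clinear_diff: "A (x - y) = A x - A y"
    and bounded_clinear_scaleC: "A (c *\<^sub>C x) = c *\<^sub>C A x"
    and bounded_clinear_zero: "A 0 = 0"
  using assms linear_add[of A] linear_diff[of A] linear_0[of A]
  by (auto simp: bounded_clinear_def bounded_linear.linear)

lemma bounded_clinear_compose:
  assumes "bounded_clinear A" "bounded_clinear B"
  shows "bounded_clinear (\<lambda>x. A (B x))"
  using assms by (auto simp: bounded_clinear_def bounded_linear_compose)

lemma bounded_clinear_funpow:
  fixes A :: "'h::chilbert_space \<Rightarrow> 'h"
  assumes "bounded_clinear A" shows "bounded_clinear (A ^^ n)"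
proof (induction n)
  case 0
  have "bounded_clinear (\<lambda>x :: 'h. x)" by (simp add: bounded_clinear_def bounded_linear_ident)
  then show ?case by (simp add: id_def)
next
  case (Suc n)
  then show ?case using bounded_clinear_compose[OF assms Suc] by (simp add: o_def)
qed

text \<open>The representing vector of a functional is found in the orthogonal complement of its kernel.\<close>

lemma Riesz_representation:
  fixes \<phi> :: "'h::chilbert_space \<Rightarrow> complex"
  assumes \<phi>: "bounded_clinear \<phi>"
  shows "\<exists>z. \<forall>x. \<phi> x = cinner x z"
proof (cases "\<forall>x. \<phi> x = 0")
  case True
  then show ?thesis by (intro exI[of _ 0]) simp
next
  case False
  then obtain x0 where x0: "\<phi> x0 \<noteq> 0" by blast
  let ?K = "{x. \<phi> x = 0}"
  have K: "csubspace ?K"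
    by (rule complex_vector.subspaceI)
      (simp_all add: bounded_clinear_zero[OF \<phi>] bounded_clinear_add[OF \<phi>]
        bounded_clinear_scaleC[OF \<phi>] scaleC_complex_def)
  have "closed ?K"
    by (intro closed_Collect_eq continuous_on_const
        linear_continuous_on[OF bounded_clinear_bounded_linear[OF \<phi>]])
  then obtain y where y: "\<phi> y = 0" "\<And>m. \<phi> m = 0 \<Longrightarrow> cinner (x0 - y) m = 0"
    using orthogonal_foot_exists[OF K, of x0] by auto
  define w where "w = x0 - y"
  have \<phi>w: "\<phi> w \<noteq> 0" using x0 y(1) by (simp add: w_def bounded_clinear_diff[OF \<phi>])
  then have w0: "cinner w w \<noteq> 0" using bounded_clinear_zero[OF \<phi>] by auto
  have eq: "\<phi> x * cinner w w = \<phi> w * cinner x w" for x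
  proof -
    have "\<phi> (\<phi> w *\<^sub>C x - \<phi> x *\<^sub>C w) = 0"
      by (simp add: bounded_clinear_diff[OF \<phi>] bounded_clinear_scaleC[OF \<phi>] scaleC_complex_def)
    then have "cinner w (\<phi> w *\<^sub>C x - \<phi> x *\<^sub>C w) = 0" using y(2) by (simp add: w_def)
    then have "cinner (\<phi> w *\<^sub>C x - \<phi> x *\<^sub>C w) w = 0"
      by (metis cinner_commute complex_cnj_zero)
    then show ?thesis by (simp add: cinner_diff_left cinner_scaleC_left)
  qed
  have "\<phi> x = cinner x (cnj (\<phi> w / cinner w w) *\<^sub>C w)" for x
    using eq[of x] w0 by (simp add: cinner_scaleC_right field_simps del: cinner_self_eq_0)
  then show ?thesis by blast
qed

lemma cadjoint_eqI:
  fixes A :: "'h::chilbert_space \<Rightarrow> 'h"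
  assumes "\<And>x. cinner (A x) y = cinner x z"
  shows "cadjoint A y = z"
  unfolding cadjoint_def adjoint_on_def
  by (rule the_equality) (use assms in \<open>auto intro: cinner_eqI_right\<close>)

lemma cinner_cadjoint:
  fixes A :: "'h::chilbert_space \<Rightarrow> 'h"
  assumes A: "bounded_clinear A"
  shows "cinner (A x) y = cinner x (cadjoint A y)"
proof -
  have "bounded_clinear (\<lambda>x. cinner (A x) y)"
    unfolding bounded_clinear_def
    by (auto simp: bounded_clinear_scaleC[OF A] cinner_scaleC_left scaleC_complex_def
        intro: bounded_linear_compose[OF bounded_linear_cinner_left bounded_clinear_bounded_linear[OF A]])
  from Riesz_representation[OF this] obtain z where "\<And>x. cinner (A x) y = cinner x z" by blast
  then show ?thesis using cadjoint_eqI[of A y z] by simp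
qed

lemma bounded_clinear_cadjoint:
  fixes A :: "'h::chilbert_space \<Rightarrow> 'h"
  assumes A: "bounded_clinear A"
  shows "bounded_clinear (cadjoint A)"
proof -
  note adj = cinner_cadjoint[OF A]
  have add: "cadjoint A (x + y) = cadjoint A x + cadjoint A y" for x y
    by (rule cadjoint_eqI) (simp add: cinner_add_right adj)
  have scale: "cadjoint A (c *\<^sub>C x) = c *\<^sub>C cadjoint A x" for c x
    by (rule cadjoint_eqI) (simp add: cinner_scaleC_right adj)
  obtain K where K: "0 < K" "\<And>x. norm (A x) \<le> norm x * K"
    using bounded_linear.pos_bounded[OF bounded_clinear_bounded_linear[OF A]] by blast
  have "norm (cadjoint A y) \<le> norm y * K" for y
  proof (cases "cadjoint A y = 0")
    case False
    have "(norm (cadjoint A y))\<^sup>2 = cmod (cinner (A (cadjoint A y)) y)"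
      by (simp add: adj cinner_self norm_power)
    also have "\<dots> \<le> norm (A (cadjoint A y)) * norm y" by (rule norm_cinner_le)
    also have "\<dots> \<le> norm (cadjoint A y) * K * norm y"
      by (intro mult_right_mono K) simp
    finally show ?thesis using False by (simp add: power2_eq_square mult.commute mult.left_commute)
  qed (use K in simp)
  then show ?thesis
    unfolding bounded_clinear_def
    by (auto intro!: bounded_linear_intro[where K = K] simp: add scale scaleR_scaleC)
qed

lemma cadjoint_cadjoint:
  fixes A :: "'h::chilbert_space \<Rightarrow> 'h"
  assumes "bounded_clinear A"
  shows "cadjoint (cadjoint A) = A"
  using assms by (intro ext cadjoint_eqI) (metis cinner_cadjoint cinner_commute)

lemma cinner_cadjoint_funpow:
  fixes A :: "'h::chilbert_space \<Rightarrow> 'h"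
  assumes "bounded_clinear A"
  shows "cinner ((A ^^ n) x) y = cinner x ((cadjoint A ^^ n) y)"
proof (induction n arbitrary: y)
  case (Suc n)
  then show ?case
    by (simp add: cinner_cadjoint[OF assms] funpow_swap1[of "cadjoint A"])
qed simp

subsection \<open>The uniform boundedness principle\<close>

text \<open>By the Baire category theorem, one of the closed sets \<open>{x. \<forall>k. norm (F k x) \<le> n}\<close> contains a
  ball; translating the ball to the origin and scaling gives a common operator bound.\<close>

lemma uniform_boundedness_principle:
  fixes F :: "'i \<Rightarrow> 'a::banach \<Rightarrow> 'b::real_normed_vector"
  assumes F: "\<And>k. bounded_linear (F k)" and bdd: "\<And>x. bounded (range (\<lambda>k. F k x))"
  shows "\<exists>C\<ge>0. \<forall>k x. norm (F k x) \<le> C * norm x"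
proof -
  define G where "G n = {x. \<forall>k. norm (F k x) \<le> real n}" for n :: nat
  have closedG: "closed (G n)" for n
    unfolding G_def
    by (intro closed_Collect_all closed_Collect_le continuous_intros linear_continuous_on F)
  have "\<exists>n. x \<in> G n" for x
  proof -
    obtain a where "\<And>k. norm (F k x) \<le> a" using bdd[of x] by (auto simp: bounded_iff)
    moreover obtain n :: nat where "a \<le> real n" using real_arch_simple by blast
    ultimately show ?thesis unfolding G_def by (intro exI[of _ n]) (auto intro: order_trans)
  qed
  then have cover: "\<Union>(range G) = UNIV" by blast
  have interior: "euclidean interior_of S = interior S" for S :: "'a set"
    by (auto simp: interior_of_def interior_def)
  have "\<exists>n. interior (G n) \<noteq> {}"
  proof (rule ccontr)
    assume "\<not> ?thesis"
    then have "Met_TC.mtopology interior_of \<Union>(range G) = {}"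
      by (intro Met_TC.metric_Baire_category_alt) (auto simp: interior closedG complete_UNIV)
    then show False by (simp add: cover interior)
  qed
  then obtain n where "interior (G n) \<noteq> {}" by blast
  then obtain x0 e where e: "0 < e" "cball x0 e \<subseteq> G n"
    by (metis ex_in_conv mem_interior_cball)
  have *: "norm (F k x) \<le> (2 * real n / e) * norm x" for k x
  proof (cases "x = 0")
    case True
    then show ?thesis using linear_0[OF bounded_linear.linear[OF F]] by simp
  next
    case False
    define u where "u = (e / norm x) *\<^sub>R x"
    have "x0 \<in> G n" "x0 + u \<in> G n"
      using e False by (auto simp: u_def dist_norm)
    then have "norm (F k (x0 + u) - F k x0) \<le> real n + real n"
      by (intro norm_triangle_le_diff add_mono) (auto simp: G_def)
    also have "F k (x0 + u) - F k x0 = (e / norm x) *\<^sub>R F k x"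
      using linear_add[OF bounded_linear.linear[OF F]] linear_scale[OF bounded_linear.linear[OF F]]
      by (simp add: u_def)
    finally show ?thesis using e False by (simp add: field_simps)
  qed
  show ?thesis using e * by (intro exI[of _ "2 * real n / e"]) auto
qed

section \<open>The Cauchy dual\<close>

lemma subspace_range:
  fixes T :: "'h::chilbert_space \<Rightarrow> 'h"
  assumes T: "bounded_clinear T"
  shows "csubspace (range T)"
  by (rule complex_vector.subspaceI)
    (auto simp: bounded_clinear_add[OF T, symmetric] bounded_clinear_scaleC[OF T, symmetric]
      bounded_clinear_zero[OF T] intro: range_eqI[of _ _ 0])

text \<open>If \<open>S\<close> is a left inverse of \<open>T\<close>, then \<open>T\<^sup>* S\<^sup>* = (S T)\<^sup>* = 1\<close>, and replacing \<open>S\<^sup>* y\<close> by its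
  projection \<open>u\<close> to the closed range of \<open>T\<close> does not change \<open>T\<^sup>* u\<close>.  So \<open>u\<close> solves \<open>T\<^sup>* u = y\<close> in the
  range of \<open>T\<close>; this solves \<open>T\<^sup>* T x = y\<close> and identifies \<open>u\<close> with \<open>T (T\<^sup>* T)\<^sup>-\<^sup>1 y\<close>.\<close>

lemma
  fixes T :: "'h::chilbert_space \<Rightarrow> 'h"
  assumes T: "bounded_clinear T" and S: "bounded_clinear S" "S \<circ> T = id"
  shows cauchy_dual_eq_proj: "cauchy_dual T y = orth_proj cinner (range T) (cadjoint S y)"
    and closed_range_left_invertible: "closed (range T)"
    and cadjoint_cauchy_dual: "cadjoint T (cauchy_dual T y) = y"
    and cauchy_dual_cadjoint: "cauchy_dual T (cadjoint T (T x)) = T x"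
proof -
  have ST: "S (T x) = x" for x using S(2) by (simp add: fun_eq_iff)
  have "range T = {y. T (S y) = y}" by (auto simp: ST) (metis rangeI)
  then show closed: "closed (range T)"
    by (simp add: closed_Collect_eq[OF _ continuous_on_id] linear_continuous_on
        bounded_clinear_bounded_linear bounded_clinear_compose T S(1))
  note sub = subspace_range[OF T]
  define V where "V y = orth_proj cinner (range T) (cadjoint S y)" for y
  have TV: "cadjoint T (V y) = y" for y
  proof (rule cadjoint_eqI)
    fix x
    have "cinner (V y) (T x) = cinner (cadjoint S y) (T x)"
      unfolding V_def by (rule cinner_orth_proj[OF sub closed]) simp
    then have "cinner (T x) (V y) = cinner (T x) (cadjoint S y)"
      by (metis cinner_commute)
    also have "\<dots> = cinner x y"
      by (simp add: cinner_cadjoint[OF S(1), symmetric] ST)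
    finally show "cinner (T x) (V y) = cinner x y" .
  qed
  have inj: "inj (cadjoint T \<circ> T)"
  proof (rule injI)
    fix x y assume "(cadjoint T \<circ> T) x = (cadjoint T \<circ> T) y"
    then have "cadjoint T (T (x - y)) = 0"
      by (simp add: bounded_clinear_diff[OF T] bounded_clinear_diff[OF bounded_clinear_cadjoint[OF T]])
    then have "cinner (T (x - y)) (T (x - y)) = 0"
      using cinner_cadjoint[OF T, of "x - y" "T (x - y)"] by simp
    then show "x = y" by (metis ST bounded_clinear_diff[OF T] cinner_self_eq_0 eq_iff_diff_eq_0)
  qed
  have eq: "cauchy_dual T y = V y" for y
  proof -
    have "V y \<in> range T" unfolding V_def by (rule orth_proj_in[OF sub closed])
    then obtain z where z: "V y = T z" by blast
    then have "(cadjoint T \<circ> T) z = y" using TV[of y] by simp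
    then have "inv (cadjoint T \<circ> T) y = z" using inj inv_f_f by metis
    then show ?thesis by (simp add: cauchy_dual_def z)
  qed
  then show "cauchy_dual T y = orth_proj cinner (range T) (cadjoint S y)" by (simp add: V_def)
  show "cadjoint T (cauchy_dual T y) = y" by (simp add: eq TV)
  show "cauchy_dual T (cadjoint T (T x)) = T x"
    using inv_f_f[OF inj, of x] by (simp add: cauchy_dual_def)
qed

lemma bounded_clinear_cauchy_dual:
  fixes T :: "'h::chilbert_space \<Rightarrow> 'h"
  assumes T: "bounded_clinear T" and S: "bounded_clinear S" "S \<circ> T = id"
  shows "bounded_clinear (cauchy_dual T)"
proof -
  note sub = subspace_range[OF T]
  have "cauchy_dual T = (\<lambda>y. orth_proj cinner (range T) (cadjoint S y))"
    using cauchy_dual_eq_proj[OF assms] by blast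
  then show ?thesis
    using bounded_clinear_compose[OF bounded_clinear_orth_proj[OF sub closed_range_left_invertible[OF assms]]
        bounded_clinear_cadjoint[OF S(1)]] by simp
qed

text \<open>The adjoint of the Cauchy dual is the left inverse of \<open>T\<close> for which \<open>T T'\<^sup>*\<close> is the orthogonal
  projection to the range of \<open>T\<close>.\<close>

locale left_invertible_operator =
  fixes T :: "'h::chilbert_space \<Rightarrow> 'h"
  assumes bounded: "bounded_clinear T" and left_invertible: "left_invertible T"
begin

abbreviation "L \<equiv> cadjoint (cauchy_dual T)"

lemma bounded_cauchy_dual: "bounded_clinear (cauchy_dual T)"
  using bounded left_invertible bounded_clinear_cauchy_dual unfolding left_invertible_def by blast

lemma bounded_L: "bounded_clinear L"
  by (rule bounded_clinear_cadjoint[OF bounded_cauchy_dual])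

lemma L_T: "L (T x) = x"
proof (rule cadjoint_eqI)
  fix u
  have "cadjoint T (cauchy_dual T u) = u"
    using bounded left_invertible cadjoint_cauchy_dual unfolding left_invertible_def by blast
  then show "cinner (cauchy_dual T u) (T x) = cinner u x"
    by (metis bounded cinner_cadjoint cinner_commute)
qed

lemma cadjoint_T_T_L: "cadjoint T (T (L x)) = cadjoint T x"
proof (rule cinner_eqI_right)
  fix u
  have *: "cauchy_dual T (cadjoint T (T u)) = T u"
    using bounded left_invertible cauchy_dual_cadjoint unfolding left_invertible_def by blast
  have "cinner u (cadjoint T (T (L x))) = cinner (T u) (T (L x))"
    by (simp add: cinner_cadjoint[OF bounded])
  also have "\<dots> = cinner (cadjoint T (T u)) (L x)"
    by (metis bounded cinner_cadjoint cinner_commute)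
  also have "\<dots> = cinner (T u) x"
    by (simp add: cinner_cadjoint[OF bounded_cauchy_dual, symmetric] *)
  finally show "cinner u (cadjoint T (T (L x))) = cinner u (cadjoint T x)"
    by (simp add: cinner_cadjoint[OF bounded])
qed

end

section \<open>Laurent series\<close>

lemma power_series_eq_0:
  fixes c :: "nat \<Rightarrow> complex"
  assumes r: "0 < r" and c: "\<And>z. cmod z < r \<Longrightarrow> (\<lambda>n. c n * z ^ n) sums 0"
  shows "c n = 0"
proof (cases n)
  case 0
  then show ?thesis using c[of 0] r by simp
next
  case (Suc m)
  show ?thesis
  proof (rule ccontr)
    assume "c n \<noteq> 0"
    show False
    proof (rule powser_0_nonzero[of r 0 c "\<lambda>_. 0" n])
      fix s :: real
      assume s: "0 < s" "\<And>z :: complex. z \<in> cball 0 s - {0} \<Longrightarrow> (0 :: complex) \<noteq> 0"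
      show False using s(2)[of "of_real s"] s(1) by simp
    qed (use r c Suc \<open>c n \<noteq> 0\<close> in simp_all)
  qed
qed

text \<open>If a Laurent series vanishes on an annulus, its regular part on the disc and the negative of its
  principal part on the exterior domain fit together to an entire function that vanishes at
  infinity.  By Liouville's theorem both parts are zero.\<close>

lemma laurent_series_eq_0:
  fixes c d :: "nat \<Rightarrow> complex"
  assumes ab: "0 \<le> a" "a < b"
    and d: "\<And>z. z \<in> annulus a b \<Longrightarrow> summable (\<lambda>n. d n * (1 / z) ^ Suc n)"
    and c: "\<And>z. z \<in> annulus a b \<Longrightarrow> summable (\<lambda>n. c n * z ^ n)"
    and zero: "\<And>z. z \<in> annulus a b \<Longrightarrow> (\<Sum>n. d n * (1 / z) ^ Suc n) + (\<Sum>n. c n * z ^ n) = 0"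
  shows "c n = 0" and "d n = 0"
proof -
  obtain s where s: "a < s" "s < b" using dense[OF ab(2)] by blast
  obtain t where t: "s < t" "t < b" using dense[OF s(2)] by blast
  have s0: "0 < s" using ab s by simp
  define d' where "d' n = (if n = 0 then 0 else d (n - 1))" for n
  define f where "f z = (\<Sum>n. c n * z ^ n)" for z
  define p where "p u = (\<Sum>n. d' n * u ^ n)" for u
  have f_sums: "(\<lambda>n. c n * z ^ n) sums f z" if "cmod z < t" for z
    unfolding f_def
    by (rule summable_sums, rule powser_inside[of c "of_real t"])
      (use c[of "of_real t"] s t s0 that in \<open>auto simp: annulus_def\<close>)
  have d'_Suc: "(\<lambda>n. d' (Suc n) * u ^ Suc n) = (\<lambda>n. d n * u ^ Suc n)" for u
    by (simp add: d'_def)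
  have "summable (\<lambda>n. d' (Suc n) * (1 / of_real s) ^ Suc n)"
    unfolding d'_Suc by (rule d) (use s s0 in \<open>simp add: annulus_def\<close>)
  then have "summable (\<lambda>n. d' n * (1 / of_real s) ^ n)"
    using summable_Suc_iff[of "\<lambda>n. d' n * (1 / of_real s) ^ n"] by blast
  then have p_sums: "(\<lambda>n. d' n * u ^ n) sums p u" if "cmod u < 1 / s" for u
    unfolding p_def using s0 that
    by (intro summable_sums, elim powser_inside) (simp add: norm_divide)
  have p_shift: "p u = (\<Sum>n. d n * u ^ Suc n)" if "cmod u < 1 / s" for u
    using suminf_split_head[OF sums_summable[OF p_sums[OF that]]]
    by (simp add: p_def d'_def)
  have f_hol: "f holomorphic_on ball 0 t"
    using power_series_holomorphic[of 0 t c f] f_sums by simp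
  have p_hol: "p holomorphic_on ball 0 (1 / s)"
    using power_series_holomorphic[of 0 "1 / s" d' p] p_sums by simp
  have inv_small: "cmod (1 / z) < 1 / s" if "s < cmod z" for z
    using that s0 by (simp add: norm_divide frac_less2)
  have g_hol: "(\<lambda>z. - p (1 / z)) holomorphic_on {z. s < cmod z}"
    by (intro holomorphic_on_minus holomorphic_on_compose_gen[OF _ p_hol, unfolded o_def]
        holomorphic_intros) (use s0 inv_small in auto)
  have glue: "f z = - p (1 / z)" if "z \<in> ball 0 t" "z \<in> {z. s < cmod z}" for z
  proof -
    have "(\<Sum>n. d n * (1 / z) ^ Suc n) + f z = 0"
      unfolding f_def by (rule zero) (use that s t in \<open>auto simp: annulus_def\<close>)
    then show ?thesis using p_shift[OF inv_small, of z] that by (simp add: add_eq_0_iff)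
  qed
  define F where "F z = (if z \<in> ball 0 t then f z else - p (1 / z))" for z
  have "F holomorphic_on ball 0 t \<union> {z. s < cmod z}"
    unfolding F_def using glue
    by (intro holomorphic_on_If_Un f_hol g_hol open_ball open_Collect_less continuous_intros)
  also have "ball 0 t \<union> {z. s < cmod z} = UNIV" using t by auto
  finally have F_hol: "F holomorphic_on UNIV" .
  have F_ext: "F z = - p (1 / z)" if "s < cmod z" for z
    using glue[of z] that by (simp add: F_def)
  have "isCont p 0"
    using holomorphic_on_imp_continuous_on[OF p_hol] s0 by (simp add: continuous_on_eq_continuous_at)
  then have "((\<lambda>z. p (inverse z)) \<longlongrightarrow> p 0) at_infinity"
    by (rule isCont_tendsto_compose) (rule tendsto_inverse_0)
  then have "((\<lambda>z. - p (inverse z)) \<longlongrightarrow> - p 0) at_infinity"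
    by (rule tendsto_minus)
  moreover have "p 0 = 0" using p_sums[of 0] s0 by (simp add: d'_def)
  moreover have "eventually (\<lambda>z. - p (inverse z) = F z) at_infinity"
    unfolding eventually_at_infinity
    by (intro exI[of _ "s + 1"]) (auto simp: F_ext inverse_eq_divide)
  ultimately have "(F \<longlongrightarrow> 0) at_infinity"
    using Lim_transform_eventually by fastforce
  then have F0: "F z = 0" for z by (rule Liouville_weak_0[OF F_hol])
  have "(\<lambda>n. c n * z ^ n) sums 0" if "cmod z < t" for z
    using f_sums[OF that] F0[of z] that by (simp add: F_def)
  then show "c n = 0" using power_series_eq_0[of t c] s0 t by simp
  have "(\<lambda>n. d' n * u ^ n) sums 0" if u: "cmod u < 1 / s" for u
  proof (cases "u = 0")
    case True
    then show ?thesis by (simp add: d'_def)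
  next
    case False
    then have "s < cmod (1 / u)" using u s0 by (simp add: norm_divide field_simps)
    then have "p u = 0" using F_ext[of "1 / u"] F0[of "1 / u"] by simp
    then show ?thesis using p_sums[OF u] by simp
  qed
  then have "d' (Suc n) = 0" using power_series_eq_0[of "1 / s" d'] s0 by simp
  then show "d n = 0" by (simp add: d'_def)
qed

text \<open>The difference quotients of the monomials are \<open>\<Sum>k<n. v^(n-1-k) u^k\<close>, which are continuous in \<open>u\<close>
  and dominated on a smaller disc by a convergent series; so the difference quotient of the power
  series extends continuously to \<open>u = v\<close>.\<close>

lemma power_series_slope:
  fixes c :: "nat \<Rightarrow> 'h::chilbert_space"
  assumes bound: "\<And>n. norm (c n) * R ^ n \<le> C" and v: "cmod v < R"
  shows "\<exists>Q. isCont Q v \<and>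
    (\<forall>\<^sub>F u in nhds v. (\<Sum>n. u ^ n *\<^sub>C c n) - (\<Sum>n. v ^ n *\<^sub>C c n) = (u - v) *\<^sub>C Q u)"
proof -
  obtain r where r: "cmod v < r" "r < R" using dense[OF v] by blast
  have r0: "0 < r" using norm_ge_zero[of v] r(1) by linarith
  have R0: "0 < R" using r0 r by simp
  define q where "q n u = (\<Sum>k<n. v ^ (n - Suc k) * u ^ k)" for n u
  define Q where "Q u = (\<Sum>n. q n u *\<^sub>C c n)" for u
  define M where "M n = (real n * r ^ (n - 1)) * (C / R ^ n)" for n
  have c_le: "norm (c n) \<le> C / R ^ n" for n
    using bound[of n] R0 by (simp add: field_simps)
  have "summable (\<lambda>n. (C / R ^ n) * x ^ n)" if "norm x < R" for x :: real
  proof -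
    have "summable (\<lambda>n. C * (x / R) ^ n)"
      using that R0 by (intro summable_mult summable_geometric) (simp add: norm_divide)
    then show ?thesis by (simp add: power_divide field_simps)
  qed
  then have geo: "summable (\<lambda>n. (C / R ^ n) * r ^ n)"
    and "summable (\<lambda>n. diffs (\<lambda>n. C / R ^ n) n * r ^ n)"
    using r r0 by (auto intro: termdiff_converges[where K = R])
  then have "summable (\<lambda>n. M (Suc n))"
    by (simp add: M_def diffs_def field_simps)
  then have M: "summable M" by (simp only: summable_Suc_iff)
  have q_le: "cmod (q n u) \<le> real n * r ^ (n - 1)" if "cmod u \<le> r" for n u
  proof -
    have "cmod (v ^ (n - Suc k) * u ^ k) \<le> r ^ (n - 1)" if "k < n" for k
    proof -
      have "cmod (v ^ (n - Suc k) * u ^ k) \<le> r ^ (n - Suc k) * r ^ k"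
        unfolding norm_mult norm_power
        using \<open>cmod u \<le> r\<close> r r0 by (intro mult_mono power_mono) auto
      also have "\<dots> = r ^ (n - 1)" using that by (simp add: power_add[symmetric])
      finally show ?thesis .
    qed
    then have "cmod (q n u) \<le> (\<Sum>k<n. r ^ (n - 1))"
      unfolding q_def by (intro sum_norm_le) auto
    then show ?thesis by simp
  qed
  have term_le: "norm (q n u *\<^sub>C c n) \<le> M n" if "u \<in> cball 0 r" for n u
    unfolding norm_scaleC M_def
    using that r0 by (intro mult_mono q_le c_le) auto
  have "uniform_limit (cball 0 r) (\<lambda>N u. \<Sum>n<N. q n u *\<^sub>C c n) Q sequentially"
    unfolding Q_def by (rule Weierstrass_m_test[OF term_le M])
  then have "continuous_on (cball 0 r) Q"
    by (rule uniform_limit_theorem[rotated])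
      (auto simp: q_def intro!: always_eventually continuous_intros
        bounded_bilinear.continuous_on[OF bounded_bilinear_scaleC])
  then have "isCont Q v"
    using r by (intro continuous_on_interior) auto
  moreover have "(\<Sum>n. u ^ n *\<^sub>C c n) - (\<Sum>n. v ^ n *\<^sub>C c n) = (u - v) *\<^sub>C Q u" if u: "cmod u < r" for u
  proof -
    have summ: "summable (\<lambda>n. w ^ n *\<^sub>C c n)" if "cmod w < r" for w
      using geo
    proof (rule summable_comparison_test'[where N = 0])
      fix n show "norm (w ^ n *\<^sub>C c n) \<le> (C / R ^ n) * r ^ n"
        unfolding norm_scaleC norm_power using c_le[of n] that
        by (subst mult.commute) (intro mult_mono power_mono, auto intro: order_trans[OF norm_ge_zero])
    qed
    have "summable (\<lambda>n. q n u *\<^sub>C c n)"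
      by (rule summable_comparison_test'[where N = 0, OF M term_le]) (use u in simp)
    then have "(u - v) *\<^sub>C Q u = (\<Sum>n. (u - v) *\<^sub>C (q n u *\<^sub>C c n))"
      unfolding Q_def by (rule bounded_linear.suminf[OF bounded_linear_scaleC_right])
    also have "\<dots> = (\<Sum>n. u ^ n *\<^sub>C c n - v ^ n *\<^sub>C c n)"
      by (simp add: scaleC_scaleC q_def power_diff_sumr2[symmetric] complex_vector.scale_left_diff_distrib)
    also have "\<dots> = (\<Sum>n. u ^ n *\<^sub>C c n) - (\<Sum>n. v ^ n *\<^sub>C c n)"
      by (intro suminf_diff[symmetric] summ u r)
    finally show ?thesis by simp
  qed
  moreover have "\<forall>\<^sub>F u in nhds v. cmod u < r"
    using r by (intro order_tendstoD(2)[of cmod "cmod v"] tendsto_norm filterlim_ident)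
  ultimately show ?thesis
    by (intro exI[of _ Q] conjI) (auto elim: eventually_mono)
qed

section \<open>Laurent series of operator orbits\<close>

text \<open>The series \<open>U\<^sub>x\<close> belongs to the pair \<open>(T, T'\<^sup>*)\<close>, the series \<open>U'\<^sub>x\<close> to the pair \<open>(T', T\<^sup>*)\<close>.\<close>

locale laurent_pair =
  fixes A B :: "'h::chilbert_space \<Rightarrow> 'h" and E :: "'h set" and a b :: real
  assumes bounded_A: "bounded_clinear A" and bounded_B: "bounded_clinear B"
    and subspace_E: "csubspace E" and closed_E: "closed E"
    and radii: "0 \<le> a" "a < b"
    and convergent: "laurent_convergent A B E (annulus a b)"
begin

abbreviation "P \<equiv> orth_proj cinner E"

definition laurent_sum :: "'h \<Rightarrow> complex \<Rightarrow> 'h"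
  where "laurent_sum x z = (\<Sum>n. principal_term A E x z n) + (\<Sum>n. regular_term B E x z n)"

lemma
  assumes "z \<in> annulus a b"
  shows summable_principal: "summable (principal_term A E x z)"
    and summable_regular: "summable (regular_term B E x z)"
  using convergent assms by (auto simp: laurent_convergent_def)

lemma bounded_P: "bounded_clinear P"
  by (rule bounded_clinear_orth_proj[OF subspace_E closed_E])

lemma bounded_principal_term: "bounded_clinear (\<lambda>x. principal_term A E x z n)"
  unfolding principal_term_def
  using bounded_clinear_compose[OF bounded_P bounded_clinear_funpow[OF bounded_A, of "Suc n"]]
  by (auto simp: bounded_clinear_def scaleC_scaleC mult.commute
      intro: bounded_linear_compose[OF bounded_linear_scaleC_right])

lemma bounded_regular_term: "bounded_clinear (\<lambda>x. regular_term B E x z n)"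
  unfolding regular_term_def
  using bounded_clinear_compose[OF bounded_P bounded_clinear_funpow[OF bounded_B, of n]]
  by (auto simp: bounded_clinear_def scaleC_scaleC mult.commute
      intro: bounded_linear_compose[OF bounded_linear_scaleC_right])

lemma laurent_sum_add:
  assumes "z \<in> annulus a b"
  shows "laurent_sum (x + y) z = laurent_sum x z + laurent_sum y z"
  using summable_principal[OF assms] summable_regular[OF assms]
  by (simp add: laurent_sum_def bounded_clinear_add[OF bounded_principal_term]
      bounded_clinear_add[OF bounded_regular_term] suminf_add[symmetric])

lemma laurent_sum_scaleC:
  assumes "z \<in> annulus a b"
  shows "laurent_sum (c *\<^sub>C x) z = c *\<^sub>C laurent_sum x z"
  using summable_principal[OF assms] summable_regular[OF assms]
  by (simp add: laurent_sum_def bounded_clinear_scaleC[OF bounded_principal_term]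
      bounded_clinear_scaleC[OF bounded_regular_term] scaleC_add_right
      bounded_linear.suminf[OF bounded_linear_scaleC_right, symmetric])

lemma subspace_closed_suminf:
  assumes "\<And>n. f n \<in> E" and "summable f"
  shows "suminf f \<in> E"
proof -
  have "(\<lambda>N. \<Sum>n<N. f n) \<longlonglongrightarrow> suminf f"
    using assms(2) by (rule summable_LIMSEQ)
  moreover have "(\<Sum>n<N. f n) \<in> E" for N
    using assms(1) by (intro complex_vector.subspace_sum[OF subspace_E]) auto
  ultimately show ?thesis using closed_sequentially[OF closed_E, of "\<lambda>N. \<Sum>n<N. f n"] by simp
qed

lemma laurent_sum_in_E:
  assumes "z \<in> annulus a b"
  shows "laurent_sum x z \<in> E"
proof -
  have "P y \<in> E" for y by (rule orth_proj_in[OF subspace_E closed_E])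
  then have "principal_term A E x z n \<in> E" "regular_term B E x z n \<in> E" for n
    unfolding principal_term_def regular_term_def
    by (blast intro: complex_vector.subspace_scale[OF subspace_E])+
  then show ?thesis
    unfolding laurent_sum_def
    by (intro complex_vector.subspace_add[OF subspace_E] subspace_closed_suminf
        summable_principal[OF assms] summable_regular[OF assms])
qed

subsection \<open>Coefficient estimates\<close>

text \<open>The terms of a convergent series are bounded.  For a fixed point of the annulus they are bounded
  operators in \<open>x\<close>, so the uniform boundedness principle turns convergence for every \<open>x\<close> into a
  Cauchy estimate that is uniform in \<open>x\<close>.\<close>

lemma
  assumes \<rho>: "a < \<rho>" "\<rho> < b"
  shows principal_coeff_bound:
      "\<exists>C\<ge>0. \<forall>n x. norm (P ((A ^^ Suc n) x)) \<le> C * \<rho> ^ Suc n * norm x" (is ?A)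
    and regular_coeff_bound:
      "\<exists>C\<ge>0. \<forall>n x. norm (P ((B ^^ n) x)) * \<rho> ^ n \<le> C * norm x" (is ?B)
proof -
  have \<rho>0: "0 < \<rho>" using radii \<rho> by simp
  have z: "complex_of_real \<rho> \<in> annulus a b" using \<rho> \<rho>0 by (simp add: annulus_def)
  have bounded_terms: "bounded (range f)" if "summable f" for f :: "nat \<Rightarrow> 'h"
    using summable_LIMSEQ_zero[OF that] convergent_imp_bounded by blast
  obtain C where C: "C \<ge> 0" "\<And>n x. norm (principal_term A E x (of_real \<rho>) n) \<le> C * norm x"
    using uniform_boundedness_principle[of "\<lambda>n x. principal_term A E x (of_real \<rho>) n"]
      bounded_clinear_bounded_linear[OF bounded_principal_term]
      bounded_terms[OF summable_principal[OF z]] by blast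
  have "norm (P ((A ^^ Suc n) x)) \<le> C * \<rho> ^ Suc n * norm x" for n x
    using C(2)[of x n] \<rho>0
    by (simp add: principal_term_def norm_scaleC norm_divide norm_mult norm_power field_simps
        del: funpow.simps)
  then show ?A using C(1) by blast
  obtain D where D: "D \<ge> 0" "\<And>n x. norm (regular_term B E x (of_real \<rho>) n) \<le> D * norm x"
    using uniform_boundedness_principle[of "\<lambda>n x. regular_term B E x (of_real \<rho>) n"]
      bounded_clinear_bounded_linear[OF bounded_regular_term]
      bounded_terms[OF summable_regular[OF z]] by blast
  have "norm (P ((B ^^ n) x)) * \<rho> ^ n \<le> D * norm x" for n x
    using D(2)[of x n] \<rho>0
    by (simp add: regular_term_def norm_scaleC norm_power mult.commute)
  then show ?B using D(1) by blast
qed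

lemma laurent_sum_bound:
  assumes "a < \<alpha>" "\<alpha> < b" "a < \<beta>" "\<beta> < b"
  shows "\<exists>C\<ge>0. \<forall>x z. \<alpha> \<le> cmod z \<and> cmod z \<le> \<beta> \<longrightarrow> norm (laurent_sum x z) \<le> C * norm x"
proof -
  obtain \<rho> where \<rho>: "a < \<rho>" "\<rho> < \<alpha>" using dense[OF assms(1)] by blast
  obtain \<sigma> where \<sigma>: "\<beta> < \<sigma>" "\<sigma> < b" using dense[OF assms(4)] by blast
  have pos: "0 < \<rho>" "0 < \<alpha>" "0 < \<beta>" "0 < \<sigma>" using radii assms \<rho> \<sigma> by auto
  obtain C where C: "C \<ge> 0" "\<And>n x. norm (P ((A ^^ Suc n) x)) \<le> C * \<rho> ^ Suc n * norm x"
    using principal_coeff_bound[of \<rho>] \<rho> assms by (meson less_trans)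
  obtain D where D: "D \<ge> 0" "\<And>n x. norm (P ((B ^^ n) x)) * \<sigma> ^ n \<le> D * norm x"
    using regular_coeff_bound[of \<sigma>] \<sigma> assms by (meson less_trans)
  have geo: "summable (\<lambda>n. (\<rho> / \<alpha>) ^ Suc n)" "summable (\<lambda>n. (\<beta> / \<sigma>) ^ n)"
    using \<rho> \<sigma> pos by (auto simp: summable_Suc_iff intro!: summable_geometric)
  define K where "K = C * (\<Sum>n. (\<rho> / \<alpha>) ^ Suc n) + D * (\<Sum>n. (\<beta> / \<sigma>) ^ n)"
  have "norm (laurent_sum x z) \<le> K * norm x" if z: "\<alpha> \<le> cmod z" "cmod z \<le> \<beta>" for x z
  proof -
    have "norm (principal_term A E x z n) \<le> (C * norm x) * (\<rho> / \<alpha>) ^ Suc n" for n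
    proof -
      have "norm (principal_term A E x z n) = norm (P ((A ^^ Suc n) x)) / cmod z ^ Suc n"
        by (simp add: principal_term_def norm_scaleC norm_divide norm_mult norm_power del: funpow.simps)
      also have "\<dots> \<le> (C * \<rho> ^ Suc n * norm x) / \<alpha> ^ Suc n"
        using pos z C by (intro frac_le C power_mono mult_nonneg_nonneg) auto
      finally show ?thesis by (simp add: power_divide mult_ac)
    qed
    then have 1: "norm (\<Sum>n. principal_term A E x z n) \<le> (\<Sum>n. (C * norm x) * (\<rho> / \<alpha>) ^ Suc n)"
      by (intro norm_suminf_le summable_mult geo)
    have "norm (regular_term B E x z n) \<le> (D * norm x) * (\<beta> / \<sigma>) ^ n" for n
    proof -
      have "norm (regular_term B E x z n) = cmod z ^ n * norm (P ((B ^^ n) x))"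
        by (simp add: regular_term_def norm_scaleC norm_power)
      also have "\<dots> \<le> \<beta> ^ n * (D * norm x / \<sigma> ^ n)"
        using pos z D(2)[of n x] by (intro mult_mono power_mono) (auto simp: field_simps)
      finally show ?thesis by (simp add: power_divide mult_ac)
    qed
    then have 2: "norm (\<Sum>n. regular_term B E x z n) \<le> (\<Sum>n. (D * norm x) * (\<beta> / \<sigma>) ^ n)"
      by (intro norm_suminf_le summable_mult geo)
    have "norm (laurent_sum x z) \<le> (\<Sum>n. (C * norm x) * (\<rho> / \<alpha>) ^ Suc n) + (\<Sum>n. (D * norm x) * (\<beta> / \<sigma>) ^ n)"
      unfolding laurent_sum_def using 1 2 by (rule norm_triangle_mono)
    also have "\<dots> = K * norm x"
      using suminf_mult[OF geo(1), of "C * norm x"] suminf_mult[OF geo(2), of "D * norm x"]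
      by (simp add: K_def algebra_simps del: power_Suc)
    finally show ?thesis .
  qed
  moreover have "K \<ge> 0"
    unfolding K_def using C D pos
    by (intro add_nonneg_nonneg mult_nonneg_nonneg suminf_nonneg geo) auto
  ultimately show ?thesis by blast
qed

subsection \<open>Holomorphy\<close>

text \<open>Both parts of the Laurent series are power series, the principal part in the variable \<open>1 / z\<close>, so
  they have continuous slope functions; the chain rule supplies the factor \<open>- 1 / z\<^sup>2\<close>.\<close>

lemma laurent_sum_complex_differentiable:
  assumes z: "z \<in> annulus a b"
  shows "\<exists>D. ((\<lambda>w. (1 / (w - z)) *\<^sub>C (laurent_sum x w - laurent_sum x z)) \<longlongrightarrow> D) (at z)"
proof -
  have z0: "z \<noteq> 0" using z radii by (auto simp: annulus_def)
  have za: "a < cmod z" "cmod z < b" using z by (auto simp: annulus_def)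
  obtain \<rho> where \<rho>: "a < \<rho>" "\<rho> < cmod z" using dense[OF za(1)] by blast
  obtain \<sigma> where \<sigma>: "cmod z < \<sigma>" "\<sigma> < b" using dense[OF za(2)] by blast
  have \<rho>0: "0 < \<rho>" using \<rho> radii by simp
  define c where "c n = (if n = 0 then 0 else P ((A ^^ n) x))" for n
  define k where "k u = (\<Sum>n. u ^ n *\<^sub>C c n)" for u
  define h where "h u = (\<Sum>n. u ^ n *\<^sub>C P ((B ^^ n) x))" for u
  obtain C where C: "C \<ge> 0" "\<And>n x. norm (P ((A ^^ Suc n) x)) \<le> C * \<rho> ^ Suc n * norm x"
    using principal_coeff_bound[of \<rho>] \<rho> za by (meson less_trans)
  have "norm (c n) * (1 / \<rho>) ^ n \<le> C * norm x" for n
  proof (cases n)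
    case (Suc m)
    then show ?thesis using C(2)[of m x] \<rho>0
      by (simp add: c_def power_divide field_simps del: funpow.simps)
  qed (simp add: c_def C)
  moreover have "cmod (1 / z) < 1 / \<rho>" using \<rho> \<rho>0 by (simp add: norm_divide frac_less2)
  ultimately obtain Q where Q: "isCont Q (1 / z)"
      "\<forall>\<^sub>F u in nhds (1 / z). k u - k (1 / z) = (u - 1 / z) *\<^sub>C Q u"
    unfolding k_def using power_series_slope by blast
  obtain D where D: "D \<ge> 0" "\<And>n x. norm (P ((B ^^ n) x)) * \<sigma> ^ n \<le> D * norm x"
    using regular_coeff_bound[of \<sigma>] \<sigma> za by (meson less_trans)
  obtain R where R: "isCont R z" "\<forall>\<^sub>F u in nhds z. h u - h z = (u - z) *\<^sub>C R u"
    unfolding h_def using power_series_slope[of "\<lambda>n. P ((B ^^ n) x)", OF D(2) \<sigma>(1)] by blast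
  have sum_eq: "laurent_sum x w = k (1 / w) + h w" if w: "w \<in> annulus a b" for w
  proof -
    have "principal_term A E x w = (\<lambda>n. (1 / w) ^ Suc n *\<^sub>C c (Suc n))"
      by (simp add: fun_eq_iff principal_term_def c_def power_divide)
    moreover from this have "summable (\<lambda>n. (1 / w) ^ n *\<^sub>C c n)"
      using summable_principal[OF w, of x] summable_Suc_iff[of "\<lambda>n. (1 / w) ^ n *\<^sub>C c n"] by simp
    ultimately show ?thesis
      using suminf_split_head[of "\<lambda>n. (1 / w) ^ n *\<^sub>C c n"]
      by (simp add: laurent_sum_def k_def h_def regular_term_def c_def)
  qed
  have inv_tendsto: "((\<lambda>w. 1 / w) \<longlongrightarrow> 1 / z) (nhds z)"
    using z0 by (intro tendsto_intros filterlim_ident)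
  have "open (annulus a b)"
    unfolding annulus_def by (intro open_Collect_conj open_Collect_less continuous_intros)
  then have "\<forall>\<^sub>F w in nhds z. w \<in> annulus a b"
    using z by (rule eventually_nhds_in_open)
  moreover have "\<forall>\<^sub>F w in nhds z. k (1 / w) - k (1 / z) = (1 / w - 1 / z) *\<^sub>C Q (1 / w)"
    using Q(2) inv_tendsto by (rule eventually_compose_filterlim)
  ultimately have "\<forall>\<^sub>F w in nhds z. w \<noteq> z \<longrightarrow>
      (- 1 / (w * z)) *\<^sub>C Q (1 / w) + R w = (1 / (w - z)) *\<^sub>C (laurent_sum x w - laurent_sum x z)"
    using R(2)
  proof eventually_elim
    case (elim w)
    show ?case
    proof
      assume wz: "w \<noteq> z"
      have w0: "w \<noteq> 0" using elim(1) radii by (auto simp: annulus_def)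
      have "laurent_sum x w - laurent_sum x z = (k (1 / w) - k (1 / z)) + (h w - h z)"
        by (simp add: sum_eq elim(1) z)
      also have "\<dots> = (1 / w - 1 / z) *\<^sub>C Q (1 / w) + (w - z) *\<^sub>C R w"
        by (simp add: elim)
      finally have "(1 / (w - z)) *\<^sub>C (laurent_sum x w - laurent_sum x z) =
          ((1 / (w - z)) * (1 / w - 1 / z)) *\<^sub>C Q (1 / w) + ((1 / (w - z)) * (w - z)) *\<^sub>C R w"
        by (simp only: scaleC_add_right scaleC_scaleC)
      moreover have "(1 / (w - z)) * (1 / w - 1 / z) = - 1 / (w * z)"
        using w0 z0 wz by (simp add: divide_simps)
      ultimately show "(- 1 / (w * z)) *\<^sub>C Q (1 / w) + R w =
          (1 / (w - z)) *\<^sub>C (laurent_sum x w - laurent_sum x z)"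
        using wz by (simp add: scaleC_one)
    qed
  qed
  then have ev: "\<forall>\<^sub>F w in at z. (- 1 / (w * z)) *\<^sub>C Q (1 / w) + R w =
      (1 / (w - z)) *\<^sub>C (laurent_sum x w - laurent_sum x z)"
    by (simp add: eventually_at_filter)
  have "((\<lambda>w. (- 1 / (w * z)) *\<^sub>C Q (1 / w) + R w) \<longlongrightarrow> (- 1 / (z * z)) *\<^sub>C Q (1 / z) + R z) (at z)"
  proof (intro tendsto_add bounded_bilinear.tendsto[OF bounded_bilinear_scaleC])
    show "((\<lambda>w. - 1 / (w * z)) \<longlongrightarrow> - 1 / (z * z)) (at z)"
      using z0 by (intro tendsto_intros) auto
    show "((\<lambda>w. Q (1 / w)) \<longlongrightarrow> Q (1 / z)) (at z)"
      using Q(1) by (rule isCont_tendsto_compose) (use z0 in \<open>auto intro!: tendsto_intros\<close>)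
    show "(R \<longlongrightarrow> R z) (at z)"
      using R(1) by (simp add: isCont_def)
  qed
  then show ?thesis using Lim_transform_eventually[OF _ ev] by blast
qed

subsection \<open>Pairing with vectors of the coefficient space\<close>

lemma
  assumes e: "e \<in> E"
  shows cinner_principal_term:
      "cinner (principal_term A E x z n) e = cinner ((A ^^ Suc n) x) e * (1 / z) ^ Suc n"
    and cinner_regular_term:
      "cinner (regular_term B E x z n) e = cinner ((B ^^ n) x) e * z ^ n"
  unfolding principal_term_def regular_term_def
  by (simp_all add: cinner_scaleC_left cinner_orth_proj[OF subspace_E closed_E e] power_divide
      mult.commute del: funpow.simps)

lemma cinner_laurent_sum:
  assumes z: "z \<in> annulus a b" and e: "e \<in> E"
  shows "summable (\<lambda>n. cinner ((A ^^ Suc n) x) e * (1 / z) ^ Suc n)"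
    and "summable (\<lambda>n. cinner ((B ^^ n) x) e * z ^ n)"
    and "cinner (laurent_sum x z) e =
      (\<Sum>n. cinner ((A ^^ Suc n) x) e * (1 / z) ^ Suc n) + (\<Sum>n. cinner ((B ^^ n) x) e * z ^ n)"
proof -
  note lin = bounded_linear_cinner_left[of e]
  show "summable (\<lambda>n. cinner ((A ^^ Suc n) x) e * (1 / z) ^ Suc n)"
    using bounded_linear.summable[OF lin summable_principal[OF z]]
    by (simp only: cinner_principal_term[OF e])
  show "summable (\<lambda>n. cinner ((B ^^ n) x) e * z ^ n)"
    using bounded_linear.summable[OF lin summable_regular[OF z]]
    by (simp only: cinner_regular_term[OF e])
  show "cinner (laurent_sum x z) e =
      (\<Sum>n. cinner ((A ^^ Suc n) x) e * (1 / z) ^ Suc n) + (\<Sum>n. cinner ((B ^^ n) x) e * z ^ n)"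
    by (simp only: laurent_sum_def cinner_add_left bounded_linear.suminf[OF lin summable_principal[OF z]]
        bounded_linear.suminf[OF lin summable_regular[OF z]] cinner_principal_term[OF e]
        cinner_regular_term[OF e])
qed

text \<open>The Laurent coefficients of \<open>cinner (laurent_sum x z) e\<close> are the inner products of \<open>x\<close> with the
  orbits of \<open>e\<close> under the adjoints, and they are unique.\<close>

lemma laurent_sum_eq_0_imp:
  assumes dense: "closure (cspan ({(cadjoint A ^^ n) e | e n. e \<in> E} \<union>
      {(cadjoint B ^^ n) e | e n. e \<in> E})) = UNIV"
    and zero: "\<And>z e. z \<in> annulus a b \<Longrightarrow> e \<in> E \<Longrightarrow> cinner (laurent_sum x z) e = 0"
  shows "x = 0"
proof -
  have coeffs: "cinner ((B ^^ n) x) e = 0" "cinner ((A ^^ Suc n) x) e = 0" if e: "e \<in> E" for e n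
  proof -
    have "(\<Sum>n. cinner ((A ^^ Suc n) x) e * (1 / z) ^ Suc n) + (\<Sum>n. cinner ((B ^^ n) x) e * z ^ n) = 0"
      if "z \<in> annulus a b" for z
      using zero[OF that e] by (simp only: cinner_laurent_sum(3)[OF that e])
    note unique = laurent_series_eq_0[where d = "\<lambda>n. cinner ((A ^^ Suc n) x) e"
        and c = "\<lambda>n. cinner ((B ^^ n) x) e",
        OF radii cinner_laurent_sum(1)[OF _ e] cinner_laurent_sum(2)[OF _ e] this]
    show "cinner ((B ^^ n) x) e = 0" by (rule unique(1))
    show "cinner ((A ^^ Suc n) x) e = 0" by (rule unique(2))
  qed
  have "cinner x ((cadjoint B ^^ n) e) = 0" if "e \<in> E" for e n
    using coeffs(1)[OF that] by (simp add: cinner_cadjoint_funpow[OF bounded_B, symmetric])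
  moreover have "cinner x ((cadjoint A ^^ n) e) = 0" if "e \<in> E" for e n
  proof (cases n)
    case 0
    then show ?thesis using coeffs(1)[OF that, of 0] by simp
  next
    case (Suc m)
    then show ?thesis
      using coeffs(2)[OF that, of m] by (simp only: cinner_cadjoint_funpow[OF bounded_A])
  qed
  ultimately have "\<forall>s\<in>{(cadjoint A ^^ n) e | e n. e \<in> E} \<union> {(cadjoint B ^^ n) e | e n. e \<in> E}. cinner x s = 0"
    by blast
  then show ?thesis using dense unfolding closure_cspan_eq_UNIV_iff by blast
qed

text \<open>The vector that represents the functional \<open>x \<mapsto> cinner (laurent_sum x z) e\<close>.\<close>

definition laurent_kernel :: "complex \<Rightarrow> 'h \<Rightarrow> 'h"
  where "laurent_kernel z e =
    (\<Sum>n. (1 / cnj z ^ Suc n) *\<^sub>C (cadjoint A ^^ Suc n) e) + (\<Sum>n. cnj z ^ n *\<^sub>C (cadjoint B ^^ n) e)"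

text \<open>The compression \<open>P A^n\<close> and the restriction of \<open>A\<^sup>*^n\<close> to \<open>E\<close> are adjoint to each other, so the
  coefficient estimates carry over to the orbits of \<open>E\<close> under the adjoints.\<close>

lemma norm_cadjoint_funpow_le:
  assumes A': "bounded_clinear A'" and e: "e \<in> E" and K: "\<And>x. norm (P ((A' ^^ n) x)) \<le> K * norm x"
  shows "norm ((cadjoint A' ^^ n) e) \<le> K * norm e"
proof (cases "(cadjoint A' ^^ n) e = 0")
  case True
  have "0 \<le> K * norm e" using K[of e] norm_ge_zero order_trans by blast
  then show ?thesis using True by simp
next
  case False
  define y where "y = (cadjoint A' ^^ n) e"
  have "complex_of_real ((norm y)\<^sup>2) = cinner y ((cadjoint A' ^^ n) e)"
    by (simp add: y_def cinner_self)
  also have "\<dots> = cinner (P ((A' ^^ n) y)) e"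
    by (simp add: cinner_cadjoint_funpow[OF A'] cinner_orth_proj[OF subspace_E closed_E e])
  finally have "(norm y)\<^sup>2 = cmod (cinner (P ((A' ^^ n) y)) e)"
    by (metis abs_of_nonneg norm_of_real zero_le_power2)
  also have "\<dots> \<le> norm (P ((A' ^^ n) y)) * norm e" by (rule norm_cinner_le)
  also have "\<dots> \<le> (K * norm y) * norm e" by (intro mult_right_mono K) simp
  finally show ?thesis using False by (simp add: y_def[symmetric] power2_eq_square mult_ac)
qed

lemma
  assumes z: "z \<in> annulus a b" and e: "e \<in> E"
  shows summable_kernel_principal: "summable (\<lambda>n. (1 / cnj z ^ Suc n) *\<^sub>C (cadjoint A ^^ Suc n) e)"
    and summable_kernel_regular: "summable (\<lambda>n. cnj z ^ n *\<^sub>C (cadjoint B ^^ n) e)"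
proof -
  have za: "a < cmod z" "cmod z < b" using z by (auto simp: annulus_def)
  obtain \<rho> where \<rho>: "a < \<rho>" "\<rho> < cmod z" using dense[OF za(1)] by blast
  obtain \<sigma> where \<sigma>: "cmod z < \<sigma>" "\<sigma> < b" using dense[OF za(2)] by blast
  have pos: "0 < \<rho>" "0 < cmod z" "0 < \<sigma>" using radii \<rho> \<sigma> by auto
  obtain C where C: "C \<ge> 0" "\<And>n x. norm (P ((A ^^ Suc n) x)) \<le> C * \<rho> ^ Suc n * norm x"
    using principal_coeff_bound[of \<rho>] \<rho> za by (meson less_trans)
  obtain D where D: "D \<ge> 0" "\<And>n x. norm (P ((B ^^ n) x)) * \<sigma> ^ n \<le> D * norm x"
    using regular_coeff_bound[of \<sigma>] \<sigma> za by (meson less_trans)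
  have geo: "summable (\<lambda>n. (C * norm e) * (\<rho> / cmod z) ^ Suc n)"
      "summable (\<lambda>n. (D * norm e) * (cmod z / \<sigma>) ^ n)"
    using \<rho> \<sigma> pos by (auto simp del: power_Suc simp: summable_Suc_iff
        intro!: summable_geometric summable_mult)
  show "summable (\<lambda>n. (1 / cnj z ^ Suc n) *\<^sub>C (cadjoint A ^^ Suc n) e)"
  proof (rule summable_comparison_test'[where N = 0, OF geo(1)])
    fix n
    have "norm ((cadjoint A ^^ Suc n) e) \<le> (C * \<rho> ^ Suc n) * norm e"
      by (rule norm_cadjoint_funpow_le[OF bounded_A e C(2)])
    then show "norm ((1 / cnj z ^ Suc n) *\<^sub>C (cadjoint A ^^ Suc n) e) \<le> (C * norm e) * (\<rho> / cmod z) ^ Suc n"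
      using pos by (simp add: norm_scaleC norm_divide norm_mult norm_power power_divide field_simps del: funpow.simps)
  qed
  show "summable (\<lambda>n. cnj z ^ n *\<^sub>C (cadjoint B ^^ n) e)"
  proof (rule summable_comparison_test'[where N = 0, OF geo(2)])
    fix n
    have "norm (P ((B ^^ n) x)) \<le> (D / \<sigma> ^ n) * norm x" for x
      using D(2)[of n x] pos by (simp add: field_simps)
    then have "norm ((cadjoint B ^^ n) e) \<le> (D / \<sigma> ^ n) * norm e"
      by (rule norm_cadjoint_funpow_le[OF bounded_B e])
    then have "cmod z ^ n * norm ((cadjoint B ^^ n) e) \<le> cmod z ^ n * ((D / \<sigma> ^ n) * norm e)"
      by (rule mult_left_mono) simp
    then show "norm (cnj z ^ n *\<^sub>C (cadjoint B ^^ n) e) \<le> (D * norm e) * (cmod z / \<sigma>) ^ n"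
      by (simp add: norm_scaleC norm_power power_divide mult_ac)
  qed
qed

lemma cinner_laurent_kernel:
  assumes z: "z \<in> annulus a b" and e: "e \<in> E"
  shows "cinner x (laurent_kernel z e) = cinner (laurent_sum x z) e"
proof -
  note lin = bounded_linear_cinner_right[of x]
  have "cinner x (laurent_kernel z e) =
      (\<Sum>n. cinner x ((1 / cnj z ^ Suc n) *\<^sub>C (cadjoint A ^^ Suc n) e)) +
      (\<Sum>n. cinner x (cnj z ^ n *\<^sub>C (cadjoint B ^^ n) e))"
    by (simp only: laurent_kernel_def cinner_add_right
        bounded_linear.suminf[OF lin summable_kernel_principal[OF z e]]
        bounded_linear.suminf[OF lin summable_kernel_regular[OF z e]])
  also have "(\<lambda>n. cinner x ((1 / cnj z ^ Suc n) *\<^sub>C (cadjoint A ^^ Suc n) e)) =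
      (\<lambda>n. cinner ((A ^^ Suc n) x) e * (1 / z) ^ Suc n)"
    by (simp add: fun_eq_iff cinner_scaleC_right cinner_cadjoint_funpow[OF bounded_A]
        power_divide del: funpow.simps power_Suc)
  also have "(\<lambda>n. cinner x (cnj z ^ n *\<^sub>C (cadjoint B ^^ n) e)) = (\<lambda>n. cinner ((B ^^ n) x) e * z ^ n)"
    by (simp add: fun_eq_iff cinner_scaleC_right cinner_cadjoint_funpow[OF bounded_B])
  finally show ?thesis by (simp only: cinner_laurent_sum(3)[OF z e])
qed

end

section \<open>The model space\<close>

locale annular_model =
  left_invertible_operator T + laurent_pair T "cadjoint (cauchy_dual T)" E a b
  for T :: "'h::chilbert_space \<Rightarrow> 'h" and E :: "'h set" and a b :: real +
  assumes dense_orbits: "closure (cspan ({(cadjoint T ^^ n) x | x n. x \<in> E} \<union>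
    {(cauchy_dual T ^^ n) x | x n. x \<in> E})) = UNIV"
begin

abbreviation "\<Omega> \<equiv> annulus a b"
abbreviation "U \<equiv> model_map T E \<Omega>"
abbreviation "\<H> \<equiv> model_space T E \<Omega>"
abbreviation "ip \<equiv> model_inner T E \<Omega>"

lemma U_eq: "U x = (\<lambda>z. if z \<in> \<Omega> then laurent_sum x z else 0)"
  by (simp add: fun_eq_iff model_map_def laurent_sum_def)

lemma U_add: "U (x + y) = U x + U y"
  by (simp add: fun_eq_iff U_eq laurent_sum_add)

lemma U_scaleC: "U (c *\<^sub>C x) = c *\<^sub>C U x"
  by (simp add: fun_eq_iff U_eq laurent_sum_scaleC scaleC_fun_def)

lemma U_diff: "U (x - y) = U x - U y"
  using U_add[of "x - y" y] by simp

lemma U_zero: "U 0 = 0"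
  using U_diff[of 0 0] by simp

lemma U_sum: "U (sum f I) = (\<Sum>i\<in>I. U (f i))"
  by (induction I rule: infinite_finite_induct) (simp_all add: U_zero U_add)

lemma inj_U: "inj U"
proof (rule injI)
  fix x y assume "U x = U y"
  then have "U (x - y) = 0" by (simp add: U_diff)
  then have "laurent_sum (x - y) z = 0" if "z \<in> \<Omega>" for z
    using that by (simp add: U_eq fun_eq_iff) metis
  then have "x - y = 0"
    by (intro laurent_sum_eq_0_imp)
      (use dense_orbits in \<open>simp_all add: cadjoint_cadjoint[OF bounded_cauchy_dual]\<close>)
  then show "x = y" by simp
qed

lemma U_in_space [simp]: "U x \<in> \<H>"
  by (simp add: model_space_def)

lemma model_inner_U: "ip (U x) (U y) = cinner x y"
  by (simp add: model_inner_def inv_f_f[OF inj_U])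

lemma model_norm_U: "model_norm T E \<Omega> (U x) = norm x"
  by (simp add: model_norm_def inv_f_f[OF inj_U])

lemma model_dist_U: "model_norm T E \<Omega> (U x - U y) = norm (x - y)"
  by (simp add: U_diff[symmetric] model_norm_U)

text \<open>Symmetry of the distance is required for arbitrary functions.  Off the model
  space it holds because \<open>inv\<close> takes the same default value at all points outside the range.\<close>

sublocale model: Metric_space \<H> "\<lambda>f g. model_norm T E \<Omega> (f - g)"
proof
  fix f g :: "complex \<Rightarrow> 'h"
  show "0 \<le> model_norm T E \<Omega> (f - g)" by (simp add: model_norm_def)
  show "model_norm T E \<Omega> (f - g) = model_norm T E \<Omega> (g - f)"
  proof (cases "f - g \<in> range U")
    case True
    then obtain x where x: "f - g = U x" by blast
    have "g - f = U (0 - x)" unfolding U_diff U_zero x[symmetric] by simp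
    then show ?thesis unfolding x by (simp only: model_norm_U) simp
  next
    case False
    moreover have "g - f \<notin> range U"
    proof
      assume "g - f \<in> range U"
      then obtain x where "g - f = U x" by blast
      then have "f - g = U (0 - x)" unfolding U_diff U_zero by (metis diff_0 minus_diff_eq)
      then show False using False by blast
    qed
    ultimately have "(\<lambda>x. U x = f - g) = (\<lambda>x. U x = g - f)"
      by (metis rangeI)
    then show ?thesis by (simp add: model_norm_def inv_into_def)
  qed
next
  fix f g assume "f \<in> \<H>" "g \<in> \<H>"
  then obtain x y where xy: "f = U x" "g = U y" unfolding model_space_def by blast
  show "model_norm T E \<Omega> (f - g) = 0 \<longleftrightarrow> f = g"
    using inj_eq[OF inj_U] by (simp add: xy U_diff[symmetric] model_norm_U)
next
  fix f g h assume "f \<in> \<H>" "g \<in> \<H>" "h \<in> \<H>"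
  then obtain x y z where "f = U x" "g = U y" "h = U z" unfolding model_space_def by blast
  then show "model_norm T E \<Omega> (f - h) \<le> model_norm T E \<Omega> (f - g) + model_norm T E \<Omega> (g - h)"
    using norm_triangle_ineq[of "x - y" "y - z"] by (simp add: U_diff[symmetric] model_norm_U)
qed

lemma model_topology_eq: "model_topology T E \<Omega> = model.mtopology"
  by (simp add: model_topology_def)

lemma model_suminf_U:
  assumes "f sums s"
  shows "model_suminf T E \<Omega> (\<lambda>n. U (f n)) = U s"
proof -
  have lim: "limitin model.mtopology (\<lambda>N. \<Sum>n<N. U (f n)) (U s) sequentially"
    unfolding model.limitin_metric
  proof (intro conjI allI impI)
    fix \<epsilon> :: real assume "0 < \<epsilon>"
    then have "\<forall>\<^sub>F N in sequentially. dist (\<Sum>n<N. f n) s < \<epsilon>"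
      using assms unfolding sums_def tendsto_iff by blast
    then show "\<forall>\<^sub>F N in sequentially. (\<Sum>n<N. U (f n)) \<in> \<H> \<and>
        model_norm T E \<Omega> ((\<Sum>n<N. U (f n)) - U s) < \<epsilon>"
      by (simp add: U_sum[symmetric] U_diff[symmetric] model_norm_U dist_norm)
  qed simp
  show ?thesis
    unfolding model_suminf_def model_topology_eq
  proof (rule the_equality)
    fix g assume "limitin model.mtopology (\<lambda>N. \<Sum>n<N. U (f n)) g sequentially"
    then show "g = U s" by (rule model.limitin_metric_unique[OF _ lim]) simp
  qed (rule lim)
qed

subsection \<open>The inclusion into the holomorphic functions\<close>

lemma U_in_Hol: "U x \<in> Hol \<Omega> E"
  unfolding Hol_def
proof (intro CollectI conjI ballI allI impI)
  fix z assume z: "z \<in> \<Omega>"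
  show "U x z \<in> E" using z by (simp add: U_eq laurent_sum_in_E)
  obtain D where D: "((\<lambda>w. (1 / (w - z)) *\<^sub>C (laurent_sum x w - laurent_sum x z)) \<longlongrightarrow> D) (at z)"
    using laurent_sum_complex_differentiable[OF z] by blast
  have "open \<Omega>"
    unfolding annulus_def by (intro open_Collect_conj open_Collect_less continuous_intros)
  then have "\<forall>\<^sub>F w in at z. w \<in> \<Omega>" using z by (rule eventually_at_in_open')
  then have "\<forall>\<^sub>F w in at z. (1 / (w - z)) *\<^sub>C (laurent_sum x w - laurent_sum x z) =
      (1 / (w - z)) *\<^sub>C (U x w - U x z)"
    by eventually_elim (simp add: U_eq z)
  then have "((\<lambda>w. (1 / (w - z)) *\<^sub>C (U x w - U x z)) \<longlongrightarrow> D) (at z)"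
    by (rule Lim_transform_eventually[OF D])
  then show "\<exists>D. ((\<lambda>w. (1 / (w - z)) *\<^sub>C (U x w - U x z)) \<longlongrightarrow> D) (at z)" ..
qed (simp add: U_eq)

lemma U_bound_on_compact:
  assumes K: "compact K" "K \<subseteq> \<Omega>"
  shows "\<exists>C\<ge>0. \<forall>x. \<forall>z\<in>K. norm (U x z) \<le> C * norm x"
proof (cases "K = {}")
  case False
  have cont: "continuous_on K cmod" by (intro continuous_intros)
  obtain z1 where z1: "z1 \<in> K" "\<And>z. z \<in> K \<Longrightarrow> cmod z1 \<le> cmod z"
    using continuous_attains_inf[OF K(1) False cont] by blast
  obtain z2 where z2: "z2 \<in> K" "\<And>z. z \<in> K \<Longrightarrow> cmod z \<le> cmod z2"
    using continuous_attains_sup[OF K(1) False cont] by blast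
  obtain C where "C \<ge> 0" "\<And>x z. cmod z1 \<le> cmod z \<and> cmod z \<le> cmod z2 \<Longrightarrow> norm (laurent_sum x z) \<le> C * norm x"
    using laurent_sum_bound[of "cmod z1" "cmod z2"] z1(1) z2(1) K(2) by (auto simp: annulus_def)
  then show ?thesis
    using z1 z2 K(2) by (intro exI[of _ C]) (auto simp: U_eq)
qed (auto intro: exI[of _ 0])

lemma continuous_inclusion: "continuous_map (model_topology T E \<Omega>) (hol_topology \<Omega> E) id"
  unfolding continuous_map_def model_topology_eq topspace_hol_topology model.topspace_mtopology
proof (intro conjI allI impI)
  show "id \<in> \<H> \<rightarrow> Hol \<Omega> E" using U_in_Hol by (auto simp: model_space_def)
  fix W assume "openin (hol_topology \<Omega> E) W"
  then have W: "hol_open \<Omega> E W" by (simp add: openin_hol_topology)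
  show "openin model.mtopology {f \<in> \<H>. id f \<in> W}"
    unfolding model.openin_mtopology
  proof (intro conjI allI impI)
    fix f assume "f \<in> {f \<in> \<H>. id f \<in> W}"
    then obtain x where f: "f = U x" "U x \<in> W" unfolding model_space_def by auto
    then obtain K \<epsilon> where K: "compact K" "K \<subseteq> \<Omega>" and \<epsilon>: "0 < \<epsilon>"
      and sub: "{g \<in> Hol \<Omega> E. \<forall>z\<in>K. norm (g z - U x z) < \<epsilon>} \<subseteq> W"
      using W unfolding hol_open_def by meson
    obtain C where C: "C \<ge> 0" "\<And>x z. z \<in> K \<Longrightarrow> norm (U x z) \<le> C * norm x"
      using U_bound_on_compact[OF K] by blast
    have "model.mball f (\<epsilon> / (C + 1)) \<subseteq> {f \<in> \<H>. id f \<in> W}"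
    proof
      fix g assume g: "g \<in> model.mball f (\<epsilon> / (C + 1))"
      then have "g \<in> \<H>" by (simp add: model.in_mball)
      then obtain y where y: "g = U y" unfolding model_space_def by blast
      have d: "norm (y - x) < \<epsilon> / (C + 1)"
        using g by (simp add: model.in_mball model_dist_U f y norm_minus_commute)
      have "norm (U y z - U x z) < \<epsilon>" if "z \<in> K" for z
      proof -
        have "norm (U y z - U x z) = norm (U (y - x) z)" by (simp add: U_diff)
        also have "\<dots> \<le> C * norm (y - x)" by (rule C(2)[OF that])
        also have "\<dots> \<le> (C + 1) * norm (y - x)" by (simp add: mult_right_mono)
        also have "\<dots> < \<epsilon>" using d C(1) by (simp add: field_simps)
        finally show ?thesis .
      qed
      then show "g \<in> {f \<in> \<H>. id f \<in> W}"
        using sub U_in_Hol y by auto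
    qed
    then show "\<exists>r>0. model.mball f r \<subseteq> {f \<in> \<H>. id f \<in> W}"
      using \<epsilon> C(1) by (intro exI[of _ "\<epsilon> / (C + 1)"]) simp
  qed auto
qed

subsection \<open>Multiplication by the variable and its left inverse\<close>

lemma laurent_sum_T:
  assumes z: "z \<in> \<Omega>"
  shows "laurent_sum (T x) z = z *\<^sub>C laurent_sum x z"
proof -
  have z0: "z \<noteq> 0" using z radii by (auto simp: annulus_def)
  note lin = bounded_linear_scaleC_right[of z]
  have p: "z *\<^sub>C principal_term T E x z (Suc n) = principal_term T E (T x) z n" for n
    using z0 by (simp add: principal_term_def scaleC_scaleC funpow_swap1)
  have r: "regular_term L E (T x) z (Suc n) = z *\<^sub>C regular_term L E x z n" for n
    by (simp add: regular_term_def scaleC_scaleC funpow_swap1[of L] L_T)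
  have pr0: "z *\<^sub>C principal_term T E x z 0 = regular_term L E (T x) z 0"
    using z0 by (simp add: principal_term_def regular_term_def scaleC_scaleC)
  have "z *\<^sub>C (\<Sum>n. principal_term T E x z n) =
      z *\<^sub>C principal_term T E x z 0 + z *\<^sub>C (\<Sum>n. principal_term T E x z (Suc n))"
    using suminf_split_head[OF summable_principal[OF z, of x]] by (simp add: scaleC_add_right[symmetric])
  also have "z *\<^sub>C (\<Sum>n. principal_term T E x z (Suc n)) = (\<Sum>n. principal_term T E (T x) z n)"
    using summable_principal[OF z, of x]
    by (subst bounded_linear.suminf[OF lin]) (simp_all add: summable_Suc_iff p)
  finally have 1: "z *\<^sub>C (\<Sum>n. principal_term T E x z n) =
      regular_term L E (T x) z 0 + (\<Sum>n. principal_term T E (T x) z n)"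
    by (simp only: pr0)
  have "z *\<^sub>C (\<Sum>n. regular_term L E x z n) = (\<Sum>n. regular_term L E (T x) z (Suc n))"
    by (simp add: r bounded_linear.suminf[OF lin summable_regular[OF z]])
  then have 2: "z *\<^sub>C (\<Sum>n. regular_term L E x z n) =
      (\<Sum>n. regular_term L E (T x) z n) - regular_term L E (T x) z 0"
    using suminf_split_head[OF summable_regular[OF z, of "T x"]] by simp
  show ?thesis by (simp add: laurent_sum_def scaleC_add_right 1 2)
qed

lemma model_Mz_U: "model_Mz (U x) = U (T x)"
  by (simp add: fun_eq_iff model_Mz_def U_eq laurent_sum_T)

lemma adjoint_Mz_U: "adjoint_on \<H> ip model_Mz (U y) = U (cadjoint T y)"
  unfolding adjoint_on_def
proof (rule the_equality)
  show "U (cadjoint T y) \<in> \<H> \<and> (\<forall>f\<in>\<H>. ip (model_Mz f) (U y) = ip f (U (cadjoint T y)))"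
    by (auto simp: model_space_def model_Mz_U model_inner_U cinner_cadjoint[OF bounded])
  fix g assume g: "g \<in> \<H> \<and> (\<forall>f\<in>\<H>. ip (model_Mz f) (U y) = ip f g)"
  then obtain v where v: "g = U v" unfolding model_space_def by blast
  have "cinner x v = cinner x (cadjoint T y)" for x
    using g U_in_space[of x] by (metis v model_Mz_U model_inner_U cinner_cadjoint[OF bounded])
  then show "g = U (cadjoint T y)" unfolding v by (metis cinner_eqI_right)
qed

lemma kernel_adj_eq: "model_kernel_adj T E \<Omega> = U ` {x. cadjoint T x = 0}"
proof -
  have zero: "U (cadjoint T y) = 0 \<longleftrightarrow> cadjoint T y = 0" for y
    using inj_eq[OF inj_U, of _ 0] by (simp add: U_zero)
  have "{f \<in> range U. Q f} = U ` {x. Q (U x)}" for Q by auto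
  from this[of "\<lambda>f. adjoint_on \<H> ip model_Mz f = 0"] show ?thesis
    by (simp only: model_kernel_adj_def adjoint_Mz_U zero model_space_def[symmetric])
qed

text \<open>The projection to the kernel of \<open>T\<^sup>*\<close> is \<open>1 - T L\<close>, since \<open>T L\<close> maps into the range of \<open>T\<close> and
  \<open>T\<^sup>* T L = T\<^sup>*\<close>.\<close>

lemma proj_kernel_adj_U: "orth_proj ip (model_kernel_adj T E \<Omega>) (U x) = U (x - T (L x))"
proof -
  let ?N = "{x. cadjoint T x = 0}"
  have in_N: "x - T (L x) \<in> ?N"
    by (simp add: bounded_clinear_diff[OF bounded_clinear_cadjoint[OF bounded]] cadjoint_T_T_L)
  show ?thesis
    unfolding orth_proj_def kernel_adj_eq
  proof (rule the_equality)
    show "U (x - T (L x)) \<in> U ` ?N \<and> (\<forall>m\<in>U ` ?N. ip (U x - U (x - T (L x))) m = 0)"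
      using in_N by (auto simp: U_diff[symmetric] model_inner_U cinner_cadjoint[OF bounded])
    fix g assume g: "g \<in> U ` ?N \<and> (\<forall>m\<in>U ` ?N. ip (U x - g) m = 0)"
    then obtain v where v: "g = U v" "v \<in> ?N" by blast
    define d where "d = (x - T (L x)) - v"
    have d: "d \<in> ?N"
      using in_N v by (simp add: d_def bounded_clinear_diff[OF bounded_clinear_cadjoint[OF bounded]])
    have "cinner (x - v) d = 0"
      using g d unfolding v by (simp add: U_diff[symmetric] model_inner_U)
    moreover have "cinner (T (L x)) d = 0"
      using d by (simp add: cinner_cadjoint[OF bounded])
    moreover have "cinner d d = cinner (x - v) d - cinner (T (L x)) d"
      by (simp add: d_def cinner_diff_left)
    ultimately have "cinner d d = 0" by (simp del: cinner_self_eq_0)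
    then show "g = U (x - T (L x))" by (simp add: d_def v)
  qed
qed

lemma model_L_U: "model_L T E \<Omega> (U x) = U (L x)"
proof
  fix z
  have "model_L T E \<Omega> (U x) z = (1 / z) *\<^sub>C U (T (L x)) z"
    unfolding model_L_def proj_kernel_adj_U by (simp add: U_diff)
  also have "\<dots> = U (L x) z"
  proof (cases "z \<in> \<Omega>")
    case True
    then have "z \<noteq> 0" using radii by (auto simp: annulus_def)
    then show ?thesis using True by (simp add: U_eq laurent_sum_T scaleC_scaleC scaleC_one)
  qed (simp add: U_eq)
  finally show "model_L T E \<Omega> (U x) z = U (L x) z" .
qed

lemma funpow_U:
  assumes "\<And>x. F (U x) = U (G x)"
  shows "(F ^^ n) (U x) = U ((G ^^ n) x)"
  by (induction n) (simp_all add: assms)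

text \<open>The unitary \<open>U\<close> intertwines \<open>L\<close> and \<open>T\<close> with the model operators, so it may be taken out of
  both series.\<close>

lemma model_Psi_eq:
  assumes "summable (\<lambda>n. (1 / \<mu> ^ Suc n) *\<^sub>C (L ^^ Suc n) e)" and "summable (\<lambda>n. \<mu> ^ n *\<^sub>C (T ^^ n) e)"
  shows "model_Psi T E \<Omega> \<mu> e =
    U ((\<Sum>n. (1 / \<mu> ^ Suc n) *\<^sub>C (L ^^ Suc n) e) + (\<Sum>n. \<mu> ^ n *\<^sub>C (T ^^ n) e))"
  unfolding model_Psi_def
  by (simp only: funpow_U[where F = "model_L T E \<Omega>" and G = L, OF model_L_U]
      funpow_U[where F = model_Mz and G = T, OF model_Mz_U] U_scaleC[symmetric] U_add
      model_suminf_U[OF summable_sums[OF assms(1)]] model_suminf_U[OF summable_sums[OF assms(2)]])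

text \<open>On the two-sided orbit series, \<open>L\<close> acts as the bilateral shift of the summation index.\<close>

lemma L_orbit_series:
  assumes \<mu>: "\<mu> \<noteq> 0"
    and neg: "summable (\<lambda>n. (1 / \<mu> ^ Suc n) *\<^sub>C (L ^^ Suc n) e)"
    and pos: "summable (\<lambda>n. \<mu> ^ n *\<^sub>C (T ^^ n) e)"
  defines "\<psi> \<equiv> (\<Sum>n. (1 / \<mu> ^ Suc n) *\<^sub>C (L ^^ Suc n) e) + (\<Sum>n. \<mu> ^ n *\<^sub>C (T ^^ n) e)"
  shows "L \<psi> = \<mu> *\<^sub>C \<psi>"
proof -
  note L_lin = bounded_clinear_bounded_linear[OF bounded_L]
  note \<mu>_lin = bounded_linear_scaleC_right[of \<mu>]
  let ?p = "\<lambda>n. (1 / \<mu> ^ Suc n) *\<^sub>C (L ^^ Suc n) e"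
  let ?r = "\<lambda>n. \<mu> ^ n *\<^sub>C (T ^^ n) e"
  have p: "L (?p n) = \<mu> *\<^sub>C ?p (Suc n)" for n
    using \<mu> by (simp add: bounded_clinear_scaleC[OF bounded_L] scaleC_scaleC)
  have r: "L (?r (Suc n)) = \<mu> *\<^sub>C ?r n" for n
    by (simp add: bounded_clinear_scaleC[OF bounded_L] scaleC_scaleC L_T)
  have pr0: "L (?r 0) = \<mu> *\<^sub>C ?p 0"
    using \<mu> by (simp add: scaleC_scaleC scaleC_one)
  have "L (suminf ?p) = \<mu> *\<^sub>C (\<Sum>n. ?p (Suc n))"
  proof -
    have "summable (\<lambda>n. ?p (Suc n))" by (rule summable_Suc_iff[THEN iffD2, OF neg])
    then show ?thesis
      by (simp only: bounded_linear.suminf[OF L_lin neg] p bounded_linear.suminf[OF \<mu>_lin])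
  qed
  also have "(\<Sum>n. ?p (Suc n)) = suminf ?p - ?p 0"
    by (rule suminf_split_head[OF neg])
  finally have 1: "L (suminf ?p) = \<mu> *\<^sub>C suminf ?p - L (?r 0)"
    by (simp only: complex_vector.scale_right_diff_distrib pr0)
  have "L (suminf ?r) = L (?r 0) + L (\<Sum>n. ?r (Suc n))"
    by (simp only: suminf_split_head[OF pos] bounded_clinear_diff[OF bounded_L]) simp
  also have "L (\<Sum>n. ?r (Suc n)) = \<mu> *\<^sub>C suminf ?r"
  proof -
    have "summable (\<lambda>n. ?r (Suc n))" by (rule summable_Suc_iff[THEN iffD2, OF pos])
    then show ?thesis
      by (simp only: bounded_linear.suminf[OF L_lin] r bounded_linear.suminf[OF \<mu>_lin pos])
  qed
  finally show ?thesis
    by (simp only: \<psi>_def bounded_clinear_add[OF bounded_L] 1 scaleC_add_right) simp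
qed

lemma dense_U_cspan:
  assumes dense: "closure (cspan S) = UNIV"
  shows "model_topology T E \<Omega> closure_of cspan (U ` S) = \<H>"
proof
  show "model_topology T E \<Omega> closure_of cspan (U ` S) \<subseteq> \<H>"
    unfolding model_topology_eq by (metis closure_of_subset_topspace model.topspace_mtopology)
  have span: "U y \<in> cspan (U ` S)" if "y \<in> cspan S" for y
    using that
  proof (induction rule: complex_vector.span_induct_alt)
    case (step c x y)
    have "U x \<in> cspan (U ` S)" using step(1) by (intro complex_vector.span_base) auto
    then show ?case
      unfolding U_add U_scaleC using step(2)
      by (intro complex_vector.span_add complex_vector.span_scale)
  qed (simp only: U_zero complex_vector.span_zero)
  show "\<H> \<subseteq> model_topology T E \<Omega> closure_of cspan (U ` S)"
    unfolding model_topology_eq model.metric_closure_of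
  proof (intro subsetI CollectI conjI allI impI)
    fix f and r :: real assume "f \<in> \<H>" "0 < r"
    then obtain x where x: "f = U x" unfolding model_space_def by blast
    have "x \<in> closure (cspan S)" using dense by simp
    then obtain y where "y \<in> cspan S" "dist y x < r"
      using \<open>0 < r\<close> unfolding closure_approachable by blast
    then show "\<exists>g\<in>cspan (U ` S). g \<in> model.mball f r"
      using span by (intro bexI[of _ "U y"]) (auto simp: x model_dist_U dist_norm norm_minus_commute)
  qed
qed

end

section \<open>Injectivity, density and eigenvectors\<close>

theorem theorem6p2:
  fixes T T' :: "'h::chilbert_space \<Rightarrow> 'h"
    and E :: "'h set"
    and r_minus r_plus r'_minus r'_plus :: real
    and \<Omega> \<Omega>' :: "complex set"
  defines "T' \<equiv> cauchy_dual T"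
    and "\<Omega> \<equiv> annulus r_minus r_plus"
    and "\<Omega>' \<equiv> annulus r'_minus r'_plus"
  assumes "bounded_clinear T" and "left_invertible T"
    and "csubspace E" and "closed E"
    and "closure (cspan ({(cadjoint T ^^ n) x | x n. x \<in> E} \<union> {(T' ^^ n) x | x n. x \<in> E})) = UNIV"
    and "closure (cspan ({(cadjoint T' ^^ n) x | x n. x \<in> E} \<union> {(T ^^ n) x | x n. x \<in> E})) = UNIV"
    and "0 \<le> r_minus" and "r_minus < r_plus"
    and "0 \<le> r'_minus" and "r'_minus < r'_plus"
    and "laurent_convergent T (cadjoint T') E \<Omega>"
    and "laurent_convergent T' (cadjoint T) E \<Omega>'"
  shows "(inj (model_map T E \<Omega>) \<and> inj_on id (model_space T E \<Omega>) \<and>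
          continuous_map (model_topology T E \<Omega>) (hol_topology \<Omega> E) id) \<and>
         model_topology T E \<Omega> closure_of
           cspan {model_Psi T E \<Omega> (cnj \<mu>) e | e \<mu>. e \<in> E \<and> \<mu> \<in> \<Omega>'} = model_space T E \<Omega> \<and>
         (\<forall>\<mu>\<in>\<Omega>'. \<forall>e\<in>E.
            model_L T E \<Omega> (model_Psi T E \<Omega> (cnj \<mu>) e) = cnj \<mu> *\<^sub>C model_Psi T E \<Omega> (cnj \<mu>) e)"
proof -
  interpret op: left_invertible_operator T
    by unfold_locales (fact assms)+
  interpret M: annular_model T E r_minus r_plus
    using assms by unfold_locales (simp_all add: op.bounded_L)
  interpret D: laurent_pair T' "cadjoint T" E r'_minus r'_plus
    using assms by unfold_locales (simp_all add: op.bounded_cauchy_dual bounded_clinear_cadjoint)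
  have adj_adj: "cadjoint (cadjoint T) = T"
    by (rule cadjoint_cadjoint[OF \<open>bounded_clinear T\<close>])
  note \<Omega>_defs = T'_def \<Omega>_def \<Omega>'_def
  \<comment> \<open>The kernel of the second Laurent map at \<open>\<mu>\<close> is the orbit series of \<open>\<Psi>\<close> at \<open>cnj \<mu>\<close>.\<close>
  have kernel: "model_Psi T E \<Omega> (cnj \<mu>) e = model_map T E \<Omega> (D.laurent_kernel \<mu> e)"
    and eigen: "cadjoint T' (D.laurent_kernel \<mu> e) = cnj \<mu> *\<^sub>C D.laurent_kernel \<mu> e"
    if \<mu>: "\<mu> \<in> \<Omega>'" and e: "e \<in> E" for \<mu> e
  proof -
    note sum = D.summable_kernel_principal[OF \<mu>[unfolded \<Omega>'_def] e]
      D.summable_kernel_regular[OF \<mu>[unfolded \<Omega>'_def] e, unfolded adj_adj]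
    show "model_Psi T E \<Omega> (cnj \<mu>) e = model_map T E \<Omega> (D.laurent_kernel \<mu> e)"
      using M.model_Psi_eq[OF sum[unfolded T'_def]]
      unfolding D.laurent_kernel_def adj_adj by (simp only: \<Omega>_defs)
    have "cnj \<mu> \<noteq> 0" using \<mu> assms by (auto simp: \<Omega>'_def annulus_def)
    from M.L_orbit_series[OF this sum[unfolded T'_def]]
    show "cadjoint T' (D.laurent_kernel \<mu> e) = cnj \<mu> *\<^sub>C D.laurent_kernel \<mu> e"
      unfolding D.laurent_kernel_def adj_adj by (simp only: T'_def)
  qed
  define S where "S = {D.laurent_kernel \<mu> e | e \<mu>. e \<in> E \<and> \<mu> \<in> \<Omega>'}"
  have "closure (cspan S) = UNIV"
    unfolding closure_cspan_eq_UNIV_iff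
  proof (intro allI impI)
    fix y assume y: "\<forall>s\<in>S. cinner y s = 0"
    show "y = 0"
    proof (rule D.laurent_sum_eq_0_imp)
      show "closure (cspan ({(cadjoint T' ^^ n) e | e n. e \<in> E} \<union>
          {(cadjoint (cadjoint T) ^^ n) e | e n. e \<in> E})) = UNIV"
        unfolding adj_adj by fact
      fix z e assume z: "z \<in> annulus r'_minus r'_plus" and e: "e \<in> E"
      then have "D.laurent_kernel z e \<in> S" by (auto simp: S_def \<Omega>'_def)
      then show "cinner (D.laurent_sum y z) e = 0"
        using y D.cinner_laurent_kernel[OF z e] by metis
    qed
  qed
  moreover have "{model_Psi T E \<Omega> (cnj \<mu>) e | e \<mu>. e \<in> E \<and> \<mu> \<in> \<Omega>'} = model_map T E \<Omega> ` S"
  proof -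
    have "{model_Psi T E \<Omega> (cnj \<mu>) e | e \<mu>. e \<in> E \<and> \<mu> \<in> \<Omega>'} =
        {model_map T E \<Omega> (D.laurent_kernel \<mu> e) | e \<mu>. e \<in> E \<and> \<mu> \<in> \<Omega>'}"
      by (intro Collect_cong) (metis kernel)
    then show ?thesis unfolding S_def by blast
  qed
  ultimately have "model_topology T E \<Omega> closure_of
      cspan {model_Psi T E \<Omega> (cnj \<mu>) e | e \<mu>. e \<in> E \<and> \<mu> \<in> \<Omega>'} = model_space T E \<Omega>"
    using M.dense_U_cspan[of S] by (simp only: \<Omega>_def)
  moreover have "model_L T E \<Omega> (model_Psi T E \<Omega> (cnj \<mu>) e) = cnj \<mu> *\<^sub>C model_Psi T E \<Omega> (cnj \<mu>) e"
    if "\<mu> \<in> \<Omega>'" "e \<in> E" for \<mu> e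
    using eigen[OF that] unfolding kernel[OF that]
    by (simp only: \<Omega>_def M.model_L_U T'_def M.U_scaleC)
  ultimately show ?thesis
    using M.inj_U M.continuous_inclusion by (simp add: \<Omega>_def)
qed

end
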